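(* Let $A,B$ be real matrices and $b,c$ real vectors of appropriate dimensions, let $X\subset\mathbb{R}^d$, put $K(x)=\{y\in\mathbb{R}^p: Ax+By\le b\}$ for $x\in X$ and $S(x)=\operatorname{argmin}_y\{\langle c,y\rangle : y\in K(x)\}$. Consider the bilevel programming problem $\min_x\theta(x,y)$ subject to $x\in X$, $y\in S(x)$, where $\theta:X\times Y\to\mathbb{R}$. Assume that: (i) the decision set $X$ is compact and $\theta$ is lower semicontinuous; (ii) $K(x)$ is bounded for each $x\in X$; (iii) $X\cap\operatorname{dom}K\neq\emptyset$. Then the problem admits a solution under the Neutral approach, and more generally under the Bayesian approach with any belief $\beta$ over $S$ admitting a continuous strictly positive density function; that is, for every such $\beta$ the function $x\mapsto\int_Y\theta(x,y)\,d\beta_x(y)$ attains its minimum over $X\cap\operatorname{dom}K$.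
   Context: $\operatorname{dom}K=\{x\in X:K(x)\ne\emptyset\}$. Points $x\in X$ with $S(x)=\emptyset$ are regarded as infeasible, i.e. $X$ is replaced by $D:=X\cap\operatorname{dom}K$ (on which $S$ has nonempty values), and beliefs and densities are considered on $D$. The ambient space is the closed convex hull $Y=\overline{\operatorname{co}}\big(\bigcup_{x\in D}S(x)\big)$, and $\mathscr{P}(Y)$ is the set of Borel probability measures on $Y$. $\operatorname{adim}(C)$ is the dimension of the affine hull of $C$; $d_x:=\operatorname{adim}(S(x))$; $\lambda_k$ is the $k$-dimensional Hausdorff measure, normalized so that it is Lebesgue measure on $k$-dimensional affine subspaces ($\lambda_0$ is counting measure). A belief over $S$ is a map $\beta:D\to\mathscr{P}(Y)$ with $\beta_x(S(x))=1$ for all $x\in D$. It admits a density function if there is $\rho:D\times Y\to[0,+\infty)$ such that for all $x\in D$, $\rho(x,\cdot)|_{S(x)}$ is $\lambda_{d_x}$-measurable with $0<\int_{S(x)}\rho(x,y)\,d\lambda_{d_x}(y)<+\infty$, and $\beta_x(A)=\int_{A\cap S(x)}\rho(x,y)\,d\lambda_{d_x}(y)\big/\int_{S(x)}\rho(x,y)\,d\lambda_{d_x}(y)$ for all Borel $A\subset Y$. The Neutral belief is $\iota_x(A)=\lambda_{d_x}(A\cap S(x))/\lambda_{d_x}(S(x))$. The Bayesian approach with belief $\beta$ is the problem $\min_{x\in D}\int_Y\theta(x,y)\,d\beta_x(y)$; the Neutral approach is the case $\beta=\iota$. *)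

theory Defs
  imports "HOL-Probability.Probability"
begin

definition lower_semicontinuous_on :: "'a::topological_space set \<Rightarrow> ('a \<Rightarrow> real) \<Rightarrow> bool" where
  "lower_semicontinuous_on T f \<longleftrightarrow>
     (\<forall>x\<in>T. \<forall>t. t < f x \<longrightarrow> (\<forall>\<^sub>F z in at x within T. t < f z))"

(* Hausdorff measure of dimension k. The weight of a covering set E is the volume of a
   k-dimensional ball with the same diameter; by the isodiametric inequality this is the
   normalization that gives Lebesgue measure on k-dimensional affine subspaces. For k = 0 every
   nonempty set has weight 1, which gives counting measure. Covering sets must be bounded
   because diameter is unspecified on unbounded sets. *)

definition hausdorff_weight :: "nat \<Rightarrow> 'a::metric_space set \<Rightarrow> ennreal" where
  "hausdorff_weight k E =
     (if E = {} then 0 else ennreal (unit_ball_vol (real k) * (diameter E / 2) ^ k))"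

definition hausdorff_content :: "nat \<Rightarrow> real \<Rightarrow> 'a::metric_space set \<Rightarrow> ennreal" where
  "hausdorff_content k \<delta> E =
     (INF U \<in> {U :: nat \<Rightarrow> 'a set.
                 E \<subseteq> (\<Union>i. U i) \<and> (\<forall>i. bounded (U i) \<and> diameter (U i) \<le> \<delta>)}.
        \<Sum>i. hausdorff_weight k (U i))"

definition hausdorff_outer_measure :: "nat \<Rightarrow> 'a::metric_space set \<Rightarrow> ennreal" where
  "hausdorff_outer_measure k E = (SUP \<delta>\<in>{0<..}. hausdorff_content k \<delta> E)"

(* The measurable sets are all Caratheodory-measurable sets, so this is a complete measure
   whose sigma-algebra contains the Borel sets. *)
definition hausdorff_measure :: "nat \<Rightarrow> 'a::metric_space measure" where
  "hausdorff_measure k =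
     measure_of UNIV (lambda_system UNIV UNIV (hausdorff_outer_measure k))
       (hausdorff_outer_measure k)"

(* For a nonempty set aff_dim is nonnegative, so nat does not truncate. *)
definition adim :: "'a::euclidean_space set \<Rightarrow> nat" where
  "adim C = nat (aff_dim C)"

definition belief_over ::
  "'a set \<Rightarrow> 'b::euclidean_space set \<Rightarrow> ('a \<Rightarrow> 'b set) \<Rightarrow> ('a \<Rightarrow> 'b measure) \<Rightarrow> bool" where
  "belief_over D Y S \<beta> \<longleftrightarrow>
     (\<forall>x\<in>D. \<beta> x \<in> space (prob_algebra (restrict_space borel Y)) \<and> emeasure (\<beta> x) (S x) = 1)"

definition density_of_belief ::
  "'a set \<Rightarrow> 'b::euclidean_space set \<Rightarrow> ('a \<Rightarrow> 'b set) \<Rightarrow> ('a \<Rightarrow> 'b measure) \<Rightarrow>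
     ('a \<times> 'b \<Rightarrow> real) \<Rightarrow> bool" where
  "density_of_belief D Y S \<beta> \<rho> \<longleftrightarrow>
     (\<forall>x\<in>D. \<forall>y\<in>Y. 0 \<le> \<rho> (x, y)) \<and>
     (\<forall>x\<in>D.
        let l = hausdorff_measure (adim (S x));
            I = (\<lambda>A. \<integral>\<^sup>+y\<in>A. ennreal (\<rho> (x, y)) \<partial>l)
        in (\<lambda>y. \<rho> (x, y)) \<in> borel_measurable (restrict_space l (S x)) \<and>
           0 < I (S x) \<and> I (S x) < \<infinity> \<and>
           (\<forall>A\<in>sets (restrict_space borel Y). emeasure (\<beta> x) A = I (A \<inter> S x) / I (S x)))"

definition neutral_belief :: "'b::euclidean_space set \<Rightarrow> ('a \<Rightarrow> 'b set) \<Rightarrow> 'a \<Rightarrow> 'b measure" where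
  "neutral_belief Y S x =
     (let l = hausdorff_measure (adim (S x))
      in measure_of Y (sets (restrict_space borel Y))
           (\<lambda>A. emeasure l (A \<inter> S x) / emeasure l (S x)))"

(* Integral with values in the extended reals, since a lower semicontinuous function that is bounded
   below need not be bounded above, and its integral may be +\<infinity> (for which the Bochner integral
   would return 0). ennreal truncates negative arguments to 0, so the two terms are the
   integrals of the positive and the negative part. *)
definition ereal_integral :: "'b measure \<Rightarrow> ('b \<Rightarrow> real) \<Rightarrow> ereal" where
  "ereal_integral M f =
     enn2ereal (\<integral>\<^sup>+y. ennreal (f y) \<partial>M) - enn2ereal (\<integral>\<^sup>+y. ennreal (- f y) \<partial>M)"

definition bayesian_solution ::
  "'a set \<Rightarrow> ('a \<times> 'b \<Rightarrow> real) \<Rightarrow> ('a \<Rightarrow> 'b measure) \<Rightarrow> 'a \<Rightarrow> bool" where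
  "bayesian_solution D \<theta> \<beta> x \<longleftrightarrow>
     is_arg_min (\<lambda>x. ereal_integral (\<beta> x) (\<lambda>y. \<theta> (x, y))) (\<lambda>x. x \<in> D) x"

end

theory Submission
  imports Defs
begin

text \<open>
  Write \<open>J x\<close> for the integral of \<open>\<theta> (x, y) * \<rho> (x, y)\<close> over \<open>S x\<close> (after adding a constant that makes
  \<open>\<theta>\<close> nonnegative) and \<open>R x\<close> for the integral of \<open>\<rho> (x, y)\<close>, both with respect to the Hausdorff
  measure of the dimension of \<open>S x\<close>. The expected cost is \<open>J x / R x\<close>, and it is enough that this
  ratio is lower semicontinuous on the compact set \<open>D\<close>. The difficulty is that the dimension may drop
  in the limit \<open>x n \<longlonglongrightarrow> x0\<close>.

  The values \<open>S x\<close> are polyhedra with fixed normals, so if \<open>y n \<in> S (x n)\<close> converges to \<open>y0\<close> and \<open>z\<close> lies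
  in the relative interior of \<open>S x0\<close>, then \<open>z + (y n - y0) \<in> S (x n)\<close> eventually. Hence the slices of
  \<open>S (x n)\<close> parallel to the direction space \<open>L\<close> of \<open>S x0\<close> converge to \<open>S x0\<close>: uniformly in
  \<open>y \<in> S (x n)\<close>, the integral \<open>G y\<close> of \<open>\<theta> * \<rho>\<close> over the slice through \<open>y\<close> is in the limit at least \<open>J x0\<close>
  (Fatou), and the integral \<open>\<Phi> y\<close> of \<open>\<rho>\<close> over the reflected slice is at most \<open>R x0\<close> (reverse Fatou).
  Since the Hausdorff measure on the affine hull of \<open>S (x n)\<close> is invariant under translation by \<open>L\<close>,
  Fubini shows that the integrals of \<open>\<rho> * G\<close> and of \<open>\<theta> * \<rho> * \<Phi>\<close> over \<open>S (x n)\<close> agree. In the limit this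
  gives \<open>J x0 * R (x n) \<le> R x0 * J (x n)\<close>.

  The normalization of the Hausdorff measures plays no role. It suffices that they behave well under
  Lipschitz maps, are finite on bounded subsets of affine subspaces of the same dimension, and are
  positive on convex sets of that dimension.
\<close>

section \<open>Hausdorff outer measure\<close>

lemma hausdorff_content_upper:
  assumes "E \<subseteq> (\<Union>i. U i)" "\<And>i::nat. bounded (U i)" "\<And>i. diameter (U i) \<le> \<delta>"
  shows "hausdorff_content k \<delta> E \<le> (\<Sum>i. hausdorff_weight k (U i))"
  unfolding hausdorff_content_def using assms by (intro INF_lower) auto

lemma hausdorff_content_greatest:
  assumes "\<And>U::nat \<Rightarrow> 'a::metric_space set. E \<subseteq> (\<Union>i. U i) \<Longrightarrow> (\<And>i. bounded (U i)) \<Longrightarrow>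
    (\<And>i. diameter (U i) \<le> \<delta>) \<Longrightarrow> c \<le> (\<Sum>i. hausdorff_weight k (U i))"
  shows "c \<le> hausdorff_content k \<delta> E"
  unfolding hausdorff_content_def using assms by (intro INF_greatest) auto

lemma hausdorff_content_approx:
  fixes E :: "'a::metric_space set"
  assumes "hausdorff_content k \<delta> E < \<top>" "0 < (e::real)"
  obtains U :: "nat \<Rightarrow> 'a set" where "E \<subseteq> (\<Union>i. U i)" "\<And>i. bounded (U i)"
    "\<And>i. diameter (U i) \<le> \<delta>" "(\<Sum>i. hausdorff_weight k (U i)) \<le> hausdorff_content k \<delta> E + ennreal e"
proof -
  have "hausdorff_content k \<delta> E < hausdorff_content k \<delta> E + ennreal e"
    using assms ennreal_add_left_cancel_less[of "hausdorff_content k \<delta> E" 0 "ennreal e"] by auto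
  then show thesis
    by (subst (asm) (1) hausdorff_content_def)
       (use that in \<open>auto simp: INF_less_iff less_imp_le\<close>)
qed

lemma hausdorff_content_mono:
  "E \<subseteq> F \<Longrightarrow> hausdorff_content k \<delta> E \<le> hausdorff_content k \<delta> F"
  unfolding hausdorff_content_def by (rule INF_superset_mono) auto

lemma hausdorff_content_antimono:
  "\<delta> \<le> \<delta>' \<Longrightarrow> hausdorff_content k \<delta>' E \<le> hausdorff_content k \<delta> E"
  unfolding hausdorff_content_def by (rule INF_superset_mono) (auto intro: order_trans)

lemma hausdorff_content_empty: "0 \<le> \<delta> \<Longrightarrow> hausdorff_content k \<delta> {} = 0"
  using hausdorff_content_upper[of "{}" "\<lambda>_. {}" \<delta> k] by (simp add: hausdorff_weight_def)

text \<open>Near-optimal covers of the sets \<open>A i\<close>, with the error \<open>e\<close>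
  split as \<open>e * (1/2)^Suc i\<close>, are merged into one sequence through the pairing of
  natural numbers. A set of infinite content would have no near-optimal cover, hence the detour
  through a finite sum.\<close>

lemma hausdorff_content_UN:
  fixes A :: "nat \<Rightarrow> 'a::metric_space set"
  shows "hausdorff_content k \<delta> (\<Union>i. A i) \<le> (\<Sum>i. hausdorff_content k \<delta> (A i))"
proof (rule ennreal_le_epsilon)
  fix e :: real assume fin: "(\<Sum>i. hausdorff_content k \<delta> (A i)) < \<top>" and e: "0 < e"
  have c: "hausdorff_content k \<delta> (A i) < \<top>" for i
    using fin ennreal_suminf_lessD by blast
  have "\<exists>U::nat \<Rightarrow> 'a set. A i \<subseteq> (\<Union>j. U j) \<and> (\<forall>j. bounded (U j)) \<and> (\<forall>j. diameter (U j) \<le> \<delta>) \<and>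
      (\<Sum>j. hausdorff_weight k (U j)) \<le> hausdorff_content k \<delta> (A i) + ennreal (e * (1/2)^Suc i)" for i
    by (rule hausdorff_content_approx[OF c[of i], of "e * (1/2)^Suc i"]) (use e in auto)
  then obtain U :: "nat \<Rightarrow> nat \<Rightarrow> 'a set" where U:
    "\<And>i. A i \<subseteq> (\<Union>j. U i j)" "\<And>i j. bounded (U i j)" "\<And>i j. diameter (U i j) \<le> \<delta>"
    "\<And>i. (\<Sum>j. hausdorff_weight k (U i j)) \<le> hausdorff_content k \<delta> (A i) + ennreal (e * (1/2)^Suc i)"
    by metis
  define V where "V n = (case prod_decode n of (i, j) \<Rightarrow> U i j)" for n
  have cov: "(\<Union>i. A i) \<subseteq> (\<Union>n. V n)"
  proof safe
    fix x i assume "x \<in> A i"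
    then obtain j where "x \<in> U i j" using U(1) by blast
    then have "x \<in> V (prod_encode (i, j))" by (simp add: V_def)
    then show "x \<in> (\<Union>n. V n)" by blast
  qed
  have "hausdorff_content k \<delta> (\<Union>i. A i) \<le> (\<Sum>n. hausdorff_weight k (V n))"
    by (rule hausdorff_content_upper[OF cov]) (auto simp: V_def U split: prod.split)
  also have "\<dots> = (\<Sum>i. \<Sum>j. hausdorff_weight k (U i j))"
    using suminf_ennreal_2dimen[of "\<lambda>i. \<Sum>j. hausdorff_weight k (U i j)" "\<lambda>(i,j). hausdorff_weight k (U i j)"]
    by (simp add: V_def case_prod_beta)
  also have "\<dots> \<le> (\<Sum>i. hausdorff_content k \<delta> (A i) + ennreal (e * (1/2)^Suc i))"
    by (intro suminf_le U) auto
  also have "\<dots> = (\<Sum>i. hausdorff_content k \<delta> (A i)) + (\<Sum>i. ennreal (e * (1/2)^Suc i))"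
    by (intro suminf_add[symmetric]) auto
  also have "(\<Sum>i. ennreal (e * (1/2)^Suc i)) = ennreal e"
    using sums_mult[OF power_half_series, of e] e
    by (intro suminf_ennreal_eq) auto
  finally show "hausdorff_content k \<delta> (\<Union>i. A i) \<le> (\<Sum>i. hausdorff_content k \<delta> (A i)) + ennreal e" .
qed

lemma hausdorff_content_le_outer:
  "0 < \<delta> \<Longrightarrow> hausdorff_content k \<delta> E \<le> hausdorff_outer_measure k E"
  unfolding hausdorff_outer_measure_def by (intro SUP_upper) auto

lemma hausdorff_outer_mono:
  "E \<subseteq> F \<Longrightarrow> hausdorff_outer_measure k E \<le> hausdorff_outer_measure k F"
  unfolding hausdorff_outer_measure_def by (intro SUP_mono) (auto intro: hausdorff_content_mono)

lemma hausdorff_outer_empty: "hausdorff_outer_measure k {} = 0"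
  unfolding hausdorff_outer_measure_def by (auto simp: hausdorff_content_empty)

lemma hausdorff_outer_UN:
  "hausdorff_outer_measure k (\<Union>i::nat. A i) \<le> (\<Sum>i. hausdorff_outer_measure k (A i))"
proof -
  have "hausdorff_content k \<delta> (\<Union>i. A i) \<le> (\<Sum>i. hausdorff_outer_measure k (A i))" if "0 < \<delta>" for \<delta>
    using that
    by (intro order_trans[OF hausdorff_content_UN] suminf_le hausdorff_content_le_outer) auto
  then show ?thesis
    by (subst hausdorff_outer_measure_def) (auto intro: SUP_least)
qed

section \<open>The Caratheodory measure space\<close>

lemma outer_measure_space_hausdorff: "outer_measure_space UNIV (hausdorff_outer_measure k)"
  unfolding outer_measure_space_def positive_def increasing_def countably_subadditive_def
  by (auto simp: hausdorff_outer_empty hausdorff_outer_mono hausdorff_outer_UN)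

lemma measure_space_hausdorff:
  "measure_space UNIV (lambda_system UNIV UNIV (hausdorff_outer_measure k)) (hausdorff_outer_measure k)"
proof -
  interpret sigma_algebra UNIV "UNIV :: 'a set set"
    using sigma_algebra_Pow[of UNIV] by simp
  show ?thesis by (rule caratheodory_lemma[OF outer_measure_space_hausdorff])
qed

lemma space_hausdorff_measure [simp]: "space (hausdorff_measure k) = UNIV"
  unfolding hausdorff_measure_def by (rule space_measure_of) auto

text \<open>The lambda system of an outer measure is already a sigma-algebra, so
  \<open>measure_of\<close> generates no further sets from it.\<close>

lemma sets_hausdorff_measure:
  "sets (hausdorff_measure k :: 'a::metric_space measure) = lambda_system UNIV UNIV (hausdorff_outer_measure k)"
  unfolding hausdorff_measure_def
  using measure_space_hausdorff[of k, where ?'a='a] sigma_algebra.sigma_sets_eq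
  by (auto simp: measure_space_def)

lemma emeasure_hausdorff_measure:
  "A \<in> sets (hausdorff_measure k) \<Longrightarrow> emeasure (hausdorff_measure k) A = hausdorff_outer_measure k A"
  using measure_space_hausdorff[of k] unfolding sets_hausdorff_measure
  by (auto simp: measure_space_def hausdorff_measure_def intro!: emeasure_measure_of_sigma)

section \<open>Separated sets and measurability of Borel sets\<close>

lemma hausdorff_outer_Un:
  fixes A B :: "'a::metric_space set"
  shows "hausdorff_outer_measure k (A \<union> B) \<le> hausdorff_outer_measure k A + hausdorff_outer_measure k B"
proof -
  have "subadditive UNIV (hausdorff_outer_measure k :: 'a set \<Rightarrow> ennreal)"
  proof -
    interpret sigma_algebra UNIV "UNIV :: 'a set set"
      using sigma_algebra_Pow[of UNIV] by simp
    show ?thesis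
      using outer_measure_space_hausdorff[of k, where ?'a='a]
      by (intro countably_subadditive_subadditive) (auto simp: outer_measure_space_def)
  qed
  then have d: "A \<inter> B' = {} \<Longrightarrow> hausdorff_outer_measure k (A \<union> B') \<le> hausdorff_outer_measure k A + hausdorff_outer_measure k B'" for B'
    by (simp add: subadditive_def)
  \<comment> \<open>\<open>subadditive\<close> speaks of disjoint sets, so \<open>B\<close> is first
    replaced by \<open>B - A\<close>.\<close>
  have "hausdorff_outer_measure k (A \<union> (B - A)) \<le> hausdorff_outer_measure k A + hausdorff_outer_measure k (B - A)"
    by (rule d) auto
  also have "\<dots> \<le> hausdorff_outer_measure k A + hausdorff_outer_measure k B"
    by (intro add_left_mono hausdorff_outer_mono) auto
  finally show ?thesis by simp
qed

text \<open>A cover by sets of diameter less than the gap has no member meeting both sets.\<close>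

lemma hausdorff_content_separated:
  fixes A B :: "'a::metric_space set"
  assumes r: "0 < \<delta>" "\<delta> < r" and sep: "\<And>x y. x \<in> A \<Longrightarrow> y \<in> B \<Longrightarrow> r \<le> dist x y"
  shows "hausdorff_content k \<delta> A + hausdorff_content k \<delta> B \<le> hausdorff_content k \<delta> (A \<union> B)"
proof (rule hausdorff_content_greatest)
  fix U :: "nat \<Rightarrow> 'a set"
  assume U: "A \<union> B \<subseteq> (\<Union>i. U i)" "\<And>i. bounded (U i)" "\<And>i. diameter (U i) \<le> \<delta>"
  have "hausdorff_content k \<delta> A \<le> (\<Sum>i. hausdorff_weight k (if U i \<inter> A = {} then {} else U i))"
  proof (rule hausdorff_content_upper)
    show "A \<subseteq> (\<Union>i. if U i \<inter> A = {} then {} else U i)"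
    proof
      fix x assume x: "x \<in> A"
      then obtain i where "x \<in> U i" using U(1) by blast
      then show "x \<in> (\<Union>i. if U i \<inter> A = {} then {} else U i)" using x by (intro UN_I[of i]) auto
    qed
  qed (use U r in auto)
  moreover have "hausdorff_content k \<delta> B \<le> (\<Sum>i. hausdorff_weight k (if U i \<inter> B = {} then {} else U i))"
  proof (rule hausdorff_content_upper)
    show "B \<subseteq> (\<Union>i. if U i \<inter> B = {} then {} else U i)"
    proof
      fix x assume x: "x \<in> B"
      then obtain i where "x \<in> U i" using U(1) by blast
      then show "x \<in> (\<Union>i. if U i \<inter> B = {} then {} else U i)" using x by (intro UN_I[of i]) auto
    qed
  qed (use U r in auto)
  moreover have "hausdorff_weight k (if U i \<inter> A = {} then {} else U i)
      + hausdorff_weight k (if U i \<inter> B = {} then {} else U i) \<le> hausdorff_weight k (U i)" for i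
  proof -
    have "U i \<inter> A = {} \<or> U i \<inter> B = {}"
    proof (rule ccontr)
      assume "\<not> ?thesis"
      then obtain x y where "x \<in> U i" "x \<in> A" "y \<in> U i" "y \<in> B" by blast
      then show False
        using sep[of x y] diameter_bounded_bound[OF U(2), of x i y] U(3)[of i] r by auto
    qed
    then show ?thesis by (auto simp: hausdorff_weight_def)
  qed
  ultimately have "hausdorff_content k \<delta> A + hausdorff_content k \<delta> B \<le>
    (\<Sum>i. hausdorff_weight k (if U i \<inter> A = {} then {} else U i)
      + hausdorff_weight k (if U i \<inter> B = {} then {} else U i))"
    by (subst suminf_add[symmetric]) (auto intro: add_mono)
  also have "\<dots> \<le> (\<Sum>i. hausdorff_weight k (U i))"
    by (intro suminf_le) (auto simp only: \<open>\<And>i. _ \<le> hausdorff_weight k (U i)\<close> summableI)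
  finally show "hausdorff_content k \<delta> A + hausdorff_content k \<delta> B \<le> (\<Sum>i. hausdorff_weight k (U i))" .
qed

text \<open>The two suprema run over independent scales \<open>s\<close> and \<open>t\<close>.
  Contents only grow when the scale shrinks, so both can be compared at a common
  \<open>\<delta>\<close> below the gap \<open>r\<close>, where a cover of the union splits.\<close>

lemma hausdorff_outer_separated:
  assumes r: "0 < r" and sep: "\<And>x y. x \<in> A \<Longrightarrow> y \<in> B \<Longrightarrow> r \<le> dist x y"
  shows "hausdorff_outer_measure k A + hausdorff_outer_measure k B \<le> hausdorff_outer_measure k (A \<union> B)"
proof -
  have "hausdorff_content k s A + hausdorff_content k t B \<le> hausdorff_outer_measure k (A \<union> B)"
    if "0 < s" "0 < t" for s t
  proof -
    define \<delta> where "\<delta> = min (min s t) (r/2)"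
    have d: "0 < \<delta>" "\<delta> < r" "\<delta> \<le> s" "\<delta> \<le> t" using that r by (auto simp: \<delta>_def)
    have "hausdorff_content k s A + hausdorff_content k t B \<le> hausdorff_content k \<delta> A + hausdorff_content k \<delta> B"
      using d by (intro add_mono hausdorff_content_antimono)
    also have "\<dots> \<le> hausdorff_content k \<delta> (A \<union> B)"
      using d sep by (intro hausdorff_content_separated[of \<delta> r])
    also have "\<dots> \<le> hausdorff_outer_measure k (A \<union> B)"
      using d by (intro hausdorff_content_le_outer)
    finally show ?thesis .
  qed
  then have "hausdorff_outer_measure k A + hausdorff_content k t B \<le> hausdorff_outer_measure k (A \<union> B)" if "0 < t" for t
    using that
    by (subst hausdorff_outer_measure_def, subst ennreal_SUP_add_left[symmetric]) (auto intro!: SUP_least)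
  then show ?thesis
    unfolding hausdorff_outer_measure_def[of k B]
    by (subst ennreal_SUP_add_right) (auto intro!: SUP_least)
qed


text \<open>Induction on \<open>n\<close>: the distance to \<open>F\<close> is 1-Lipschitz, it is at
  least \<open>a m\<close> on the shells up to index \<open>m\<close>, and it is below
  \<open>b (Suc m)\<close> on the next one. The new shell therefore has the gap
  \<open>a m - b (Suc m)\<close> to all earlier ones.\<close>

lemma hausdorff_outer_separated_shells:
  assumes a: "\<And>i j::nat. i \<le> j \<Longrightarrow> a j \<le> a i" and ab: "\<And>j. b (Suc j) < a j"
    and E: "\<And>j. E j \<subseteq> {x. a j \<le> infdist x F \<and> infdist x F < b j}"
  shows "(\<Sum>j<n. hausdorff_outer_measure k (E j)) \<le> hausdorff_outer_measure k (\<Union>j<n. E j)"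
proof (induction n)
  case 0
  then show ?case by (simp add: hausdorff_outer_empty)
next
  case (Suc n)
  have "(\<Sum>j<Suc n. hausdorff_outer_measure k (E j)) \<le>
      hausdorff_outer_measure k (\<Union>j<n. E j) + hausdorff_outer_measure k (E n)"
    using Suc by (simp add: add_right_mono)
  also have "\<dots> \<le> hausdorff_outer_measure k ((\<Union>j<n. E j) \<union> E n)"
  proof (cases n)
    case 0
    then show ?thesis by (simp add: hausdorff_outer_empty)
  next
    case (Suc m)
    show ?thesis
    proof (rule hausdorff_outer_separated[of "a m - b n"])
      show "0 < a m - b n" using ab[of m] Suc by simp
      fix x y assume "x \<in> (\<Union>j<n. E j)" and y: "y \<in> E n"
      then obtain i where i: "i \<le> m" "x \<in> E i" using Suc by (auto simp: less_Suc_eq_le)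
      have "infdist y F < b n" using E y by blast
      moreover have "a m \<le> infdist x F"
        using E[of i] i a[of i m] by (auto intro: order_trans)
      moreover have "infdist x F \<le> infdist y F + dist x y" by (rule infdist_triangle)
      ultimately show "a m - b n \<le> dist x y" by linarith
    qed
  qed
  also have "(\<Union>j<n. E j) \<union> E n = (\<Union>j<Suc n. E j)" by (auto simp: less_Suc_eq)
  finally show ?case .
qed

text \<open>Consecutive shells touch, but the shells of even index are separated from each other, and so
  are those of odd index.\<close>

lemma hausdorff_outer_shells:
  fixes F :: "'a::metric_space set"
  assumes R: "\<And>j. R j = {x \<in> A. 1 / real (j + 2) \<le> infdist x F \<and> infdist x F < 1 / real (j + 1)}"
  shows "(\<Sum>j. hausdorff_outer_measure k (R j)) \<le> 2 * hausdorff_outer_measure k A"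
proof -
  \<comment> \<open>The parity is \<open>c\<close>. Leaving out every second shell creates a gap
    between \<open>1 / (2 * j + c + 3)\<close> and \<open>1 / (2 * j + c + 2)\<close> in the
    distance to \<open>F\<close>.\<close>
  have even: "(\<Sum>j<n. hausdorff_outer_measure k (R (2 * j + c))) \<le> hausdorff_outer_measure k A" for n c
  proof -
    have "(\<Sum>j<n. hausdorff_outer_measure k (R (2 * j + c)))
        \<le> hausdorff_outer_measure k (\<Union>j<n. R (2 * j + c))"
      by (rule hausdorff_outer_separated_shells[where a="\<lambda>j. 1 / real (2 * j + c + 2)"
            and b="\<lambda>j. 1 / real (2 * j + c + 1)" and F=F])
         (auto simp: R field_simps)
    also have "\<dots> \<le> hausdorff_outer_measure k A" by (rule hausdorff_outer_mono) (auto simp: R)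
    finally show ?thesis .
  qed
  have split: "(\<Sum>j<2 * n. f j) = (\<Sum>j<n. f (2 * j)) + (\<Sum>j<n. f (2 * j + 1))"
    for n and f :: "nat \<Rightarrow> ennreal"
    by (induction n) (auto simp: ac_simps)
  have "(\<Sum>j<n. hausdorff_outer_measure k (R j)) \<le> 2 * hausdorff_outer_measure k A" for n
  proof -
    have "(\<Sum>j<n. hausdorff_outer_measure k (R j)) \<le> (\<Sum>j<2*n. hausdorff_outer_measure k (R j))"
      by (rule sum_mono2) auto
    also have "\<dots> \<le> hausdorff_outer_measure k A + hausdorff_outer_measure k A"
      unfolding split using even[where c=0] even[where c=1] by (intro add_mono) auto
    finally show ?thesis by (simp add: mult_2)
  qed
  then show ?thesis by (simp add: suminf_eq_SUP SUP_le_iff)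
qed

lemma ennreal_suminf_tail:
  fixes f :: "nat \<Rightarrow> ennreal"
  assumes "(\<Sum>i. f i) < \<top>" "0 < (e::real)"
  obtains n where "(\<Sum>i. f (i + n)) \<le> ennreal e"
proof -
  define r where "r i = enn2real (f i)" for i
  have "f i < \<top>" for i
    using assms ennreal_suminf_lessD by blast
  then have f: "f i = ennreal (r i)" for i by (simp add: r_def)
  have r: "0 \<le> r i" for i by (simp add: r_def)
  have s: "summable r"
    using assms by (intro summable_suminf_not_top r) (simp add: f[symmetric])
  obtain n where "norm (\<Sum>i. r (i + n)) < e"
    using suminf_exist_split[OF assms(2) s] by blast
  moreover have "(\<Sum>i. f (i + n)) = ennreal (\<Sum>i. r (i + n))"
    unfolding f using s by (intro suminf_ennreal2 r) (simp add: summable_iff_shift)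
  ultimately show thesis using that[of n] by (simp add: ennreal_leI)
qed

text \<open>Caratheodory's criterion for metric outer measures. A set \<open>A\<close> of finite
  measure is cut into \<open>F \<inter> A\<close>, the part \<open>An\<close> at distance at least
  \<open>1 / (n + 1)\<close> from \<open>F\<close>, and the shells of index at least
  \<open>n\<close> that accumulate at \<open>F\<close>. The first two parts are separated, so their
  measures add. The shells have a convergent sum, so their tail is below any
  \<open>e\<close>.\<close>

lemma closed_in_sets_hausdorff:
  fixes F :: "'a::metric_space set"
  assumes F: "closed F"
  shows "F \<in> sets (hausdorff_measure k)"
proof -
  have key: "hausdorff_outer_measure k (F \<inter> A) + hausdorff_outer_measure k (- F \<inter> A)
    \<le> hausdorff_outer_measure k A" for A
  \<comment> \<open>\<open>infdist\<close> to the empty set is 0 by convention, so distances say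
    nothing in that case.\<close>
  proof (cases "F = {} \<or> hausdorff_outer_measure k A = \<top>")
    case True
    then show ?thesis by (auto simp: hausdorff_outer_empty)
  next
    case False
    then have F0: "F \<noteq> {}" and fin: "hausdorff_outer_measure k A < \<top>"
      by (auto simp: less_top)
    define R where "R j = {x \<in> A. 1 / real (j + 2) \<le> infdist x F \<and> infdist x F < 1 / real (j + 1)}" for j
    have sumR: "(\<Sum>j. hausdorff_outer_measure k (R j)) < \<top>"
      using hausdorff_outer_shells[OF R_def, of k] fin
      by (intro le_less_trans[OF _ ennreal_mult_less_top[THEN iffD2]]) auto
    show ?thesis
    proof (rule ennreal_le_epsilon)
      fix e :: real assume "0 < e"
      then obtain n where n: "(\<Sum>j. hausdorff_outer_measure k (R (j + n))) \<le> ennreal e"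
        using ennreal_suminf_tail[OF sumR] by blast
      define An where "An = {x \<in> A. 1 / real (n + 1) \<le> infdist x F}"
      have "- F \<inter> A \<subseteq> An \<union> (\<Union>j. R (j + n))"
      proof
        fix x assume x: "x \<in> - F \<inter> A"
        then have pos: "0 < infdist x F"
          using F F0 in_closed_iff_infdist_zero[of F x] infdist_nonneg[of x F] by fastforce
        show "x \<in> An \<union> (\<Union>j. R (j + n))"
        proof (cases "1 / real (n + 1) \<le> infdist x F")
          case True
          then show ?thesis using x by (simp add: An_def)
        next
          case out: False
          \<comment> \<open>The least \<open>m\<close> with \<open>1 / (m + 1)\<close> at most the
            distance exceeds \<open>n\<close>; its predecessor is the index of the shell that
            contains \<open>x\<close>.\<close>
          define P where "P m \<longleftrightarrow> 1 / real (m + 1) \<le> infdist x F" for m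
          obtain m0 where "P m0"
            using pos nat_approx_posE[OF pos] unfolding P_def by (metis Suc_eq_plus1 less_imp_le)
          then have P: "P (LEAST m. P m)" by (rule LeastI)
          have gt: "n < (LEAST m. P m)"
          proof (rule ccontr)
            assume "\<not> n < (LEAST m. P m)"
            then have "1 / real (n + 1) \<le> 1 / real ((LEAST m. P m) + 1)"
              by (simp add: field_simps)
            then show False using P out unfolding P_def by linarith
          qed
          then obtain j where j: "(LEAST m. P m) = Suc (j + n)"
            by (metis add.commute less_imp_Suc_add add_Suc_right)
          then have "\<not> P (j + n)" using not_less_Least[of "j + n" P] by simp
          then have "x \<in> R (j + n)" using P x unfolding j by (auto simp: R_def P_def)
          then show ?thesis by blast
        qed
      qed
      then have "hausdorff_outer_measure k (- F \<inter> A) \<le> hausdorff_outer_measure k (An \<union> (\<Union>j. R (j + n)))"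
        by (rule hausdorff_outer_mono)
      also have "\<dots> \<le> hausdorff_outer_measure k An + hausdorff_outer_measure k (\<Union>j. R (j + n))"
        by (rule hausdorff_outer_Un)
      also have "\<dots> \<le> hausdorff_outer_measure k An + ennreal e"
        using hausdorff_outer_UN[of k "\<lambda>j. R (j + n)"] n by (intro add_left_mono) auto
      finally have "hausdorff_outer_measure k (F \<inter> A) + hausdorff_outer_measure k (- F \<inter> A)
          \<le> (hausdorff_outer_measure k (F \<inter> A) + hausdorff_outer_measure k An) + ennreal e"
        by (simp add: add_left_mono add.assoc)
      also have "hausdorff_outer_measure k (F \<inter> A) + hausdorff_outer_measure k An
          \<le> hausdorff_outer_measure k (F \<inter> A \<union> An)"
      proof (rule hausdorff_outer_separated[of "1 / real (n + 1)"])
        fix x y assume "x \<in> F \<inter> A" "y \<in> An"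
        then show "1 / real (n + 1) \<le> dist x y"
          using infdist_le[of x F y] by (auto simp: An_def dist_commute)
      qed auto
      also have "\<dots> \<le> hausdorff_outer_measure k A"
        by (rule hausdorff_outer_mono) (auto simp: An_def)
      finally show "hausdorff_outer_measure k (F \<inter> A) + hausdorff_outer_measure k (- F \<inter> A)
        \<le> hausdorff_outer_measure k A + ennreal e" by (simp add: add_right_mono)
    qed
  qed
  have "hausdorff_outer_measure k A \<le> hausdorff_outer_measure k (F \<inter> A) + hausdorff_outer_measure k (- F \<inter> A)" for A
    using hausdorff_outer_Un[of k "F \<inter> A" "- F \<inter> A"] by (simp add: Int_Un_distrib2[symmetric])
  then show ?thesis
    unfolding sets_hausdorff_measure lambda_system_def using key
    by (auto simp: Compl_eq_Diff_UNIV intro: antisym)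
qed

lemma borel_subset_sets_hausdorff: "sets borel \<subseteq> sets (hausdorff_measure k)"
  unfolding borel_eq_closed
  using sets.sigma_sets_subset[of "Collect closed" "hausdorff_measure k"] closed_in_sets_hausdorff
  by auto

section \<open>Lipschitz images\<close>

lemma hausdorff_content_lipschitz:
  assumes C: "0 < C" and lip: "\<And>x y. x \<in> E \<Longrightarrow> y \<in> E \<Longrightarrow> dist (f x) (f y) \<le> C * dist x y"
  shows "hausdorff_content k (C * \<delta>) (f ` E) \<le> ennreal (C ^ k) * hausdorff_content k \<delta> E"
proof -
  \<comment> \<open>A cover of \<open>E\<close> is intersected with \<open>E\<close> before it is
    mapped, because \<open>f\<close> is controlled on \<open>E\<close> only. Diameters grow at most
    by the factor \<open>C\<close>, hence weights by \<open>C ^ k\<close>. Dividing by this constant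
    puts the bare infimum on the right-hand side.\<close>
  have "hausdorff_content k (C * \<delta>) (f ` E) / ennreal (C ^ k) \<le> hausdorff_content k \<delta> E"
  proof (rule hausdorff_content_greatest)
    fix U :: "nat \<Rightarrow> 'a set"
    assume U: "E \<subseteq> (\<Union>i. U i)" "\<And>i. bounded (U i)" "\<And>i. diameter (U i) \<le> \<delta>"
    have d: "dist (f x) (f y) \<le> C * diameter (U i)" if "x \<in> E \<inter> U i" "y \<in> E \<inter> U i" for x y i
    proof -
      have "dist (f x) (f y) \<le> C * dist x y" using lip that by auto
      also have "\<dots> \<le> C * diameter (U i)"
        using C that U(2) by (intro mult_left_mono diameter_bounded_bound) auto
      finally show ?thesis .
    qed
    have b: "bounded (f ` (E \<inter> U i))" for i
    proof (cases "E \<inter> U i = {}")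
      case False
      then obtain x where "x \<in> E \<inter> U i" by blast
      then show ?thesis unfolding bounded_def
        using d by (intro exI[of _ "f x"] exI[of _ "C * diameter (U i)"]) auto
    qed auto
    have diam: "diameter (f ` (E \<inter> U i)) \<le> C * diameter (U i)" for i
    proof (cases "E \<inter> U i = {}")
      case True
      then show ?thesis using C diameter_ge_0[OF U(2)[of i]] by simp
    next
      case False
      then show ?thesis
        unfolding diameter_def[of "f ` (E \<inter> U i)"] using d[of _ i] by (auto intro!: cSUP_least)
    qed
    have w: "hausdorff_weight k (f ` (E \<inter> U i)) \<le> ennreal (C ^ k) * hausdorff_weight k (U i)" for i
    proof (cases "E \<inter> U i = {}")
      case False
      have "unit_ball_vol (real k) * (diameter (f ` (E \<inter> U i)) / 2) ^ k
          \<le> unit_ball_vol (real k) * (C * diameter (U i) / 2) ^ k"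
        using diam[of i] diameter_ge_0[OF b[of i]]
        by (intro mult_left_mono power_mono divide_right_mono) auto
      also have "\<dots> = C ^ k * (unit_ball_vol (real k) * (diameter (U i) / 2) ^ k)"
        by (simp add: power_mult_distrib power_divide)
      finally have "unit_ball_vol (real k) * (diameter (f ` (E \<inter> U i)) / 2) ^ k
          \<le> C ^ k * (unit_ball_vol (real k) * (diameter (U i) / 2) ^ k)" .
      moreover have "U i \<noteq> {}" using False by auto
      ultimately show ?thesis
        using False C by (auto simp: hausdorff_weight_def ennreal_mult'[symmetric] intro!: ennreal_leI)
    qed (simp add: hausdorff_weight_def)
    have "hausdorff_content k (C * \<delta>) (f ` E) \<le> (\<Sum>i. hausdorff_weight k (f ` (E \<inter> U i)))"
    proof (rule hausdorff_content_upper)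
      show "f ` E \<subseteq> (\<Union>i. f ` (E \<inter> U i))" using U(1) by blast
      show "diameter (f ` (E \<inter> U i)) \<le> C * \<delta>" for i
        using diam[of i] mult_left_mono[OF U(3)[of i], of C] C by linarith
    qed (rule b)
    also have "\<dots> \<le> (\<Sum>i. ennreal (C ^ k) * hausdorff_weight k (U i))"
      by (intro suminf_le w) auto
    finally have "hausdorff_content k (C * \<delta>) (f ` E) \<le> (\<Sum>i. hausdorff_weight k (U i)) * ennreal (C ^ k)"
      by (simp add: mult.commute)
    then show "hausdorff_content k (C * \<delta>) (f ` E) / ennreal (C ^ k) \<le> (\<Sum>i. hausdorff_weight k (U i))"
      using C by (intro divide_le_posI_ennreal) (auto simp: mult.commute)
  qed
  then have "ennreal (C ^ k) * (hausdorff_content k (C * \<delta>) (f ` E) / ennreal (C ^ k))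
      \<le> ennreal (C ^ k) * hausdorff_content k \<delta> E" by (rule mult_left_mono) simp
  moreover have "ennreal (C ^ k) * x / ennreal (C ^ k) = x" for x
    using mult_divide_eq_ennreal[of "ennreal (C ^ k)" x] C by (simp add: mult.commute)
  ultimately show ?thesis by (simp add: ennreal_times_divide)
qed

lemma hausdorff_outer_lipschitz:
  assumes C: "0 < C" and lip: "\<And>x y. x \<in> E \<Longrightarrow> y \<in> E \<Longrightarrow> dist (f x) (f y) \<le> C * dist x y"
  shows "hausdorff_outer_measure k (f ` E) \<le> ennreal (C ^ k) * hausdorff_outer_measure k E"
proof -
  have "hausdorff_content k \<delta> (f ` E) \<le> ennreal (C ^ k) * hausdorff_outer_measure k E" if "0 < \<delta>" for \<delta>
  proof -
    have "hausdorff_content k \<delta> (f ` E) \<le> ennreal (C ^ k) * hausdorff_content k (\<delta> / C) E"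
      using hausdorff_content_lipschitz[OF C lip, where k=k and \<delta>="\<delta> / C"] C by simp
    also have "\<dots> \<le> ennreal (C ^ k) * hausdorff_outer_measure k E"
      using that C by (intro mult_left_mono hausdorff_content_le_outer) auto
    finally show ?thesis .
  qed
  then show ?thesis
    by (subst hausdorff_outer_measure_def) (auto intro!: SUP_least)
qed

section \<open>Finite positive measure of coordinate cubes\<close>

definition coord_cube :: "'a::euclidean_space set \<Rightarrow> 'a set" where
  "coord_cube J = {y. \<forall>b\<in>Basis. if b \<in> J then 0 \<le> y \<bullet> b \<and> y \<bullet> b \<le> 1 else y \<bullet> b = 0}"

lemma norm_le_on_coordinates:
  assumes J: "J \<subseteq> Basis" and "\<And>b. b \<in> J \<Longrightarrow> \<bar>y \<bullet> b\<bar> \<le> t" "\<And>b. b \<in> Basis - J \<Longrightarrow> y \<bullet> b = 0"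
  shows "norm (y::'a::euclidean_space) \<le> real (card J) * t"
proof -
  have "norm y \<le> (\<Sum>b\<in>Basis. \<bar>y \<bullet> b\<bar>)" by (rule norm_le_l1)
  also have "\<dots> = (\<Sum>b\<in>J. \<bar>y \<bullet> b\<bar>)"
    using J assms(3) by (intro sum.mono_neutral_right) auto
  also have "\<dots> \<le> (\<Sum>b\<in>J. t)" by (intro sum_mono assms(2))
  finally show ?thesis by simp
qed

lemma coord_cube_subset_span:
  assumes "J \<subseteq> Basis" shows "coord_cube J \<subseteq> span J"
  unfolding span_substd_basis[OF assms] using assms by (auto simp: coord_cube_def)

lemma hausdorff_content_finite_cover:
  assumes I: "finite I" and E: "E \<subseteq> (\<Union>i\<in>I. U i)" and d: "0 \<le> d" "d \<le> \<delta>"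
    and U: "\<And>i. i \<in> I \<Longrightarrow> bounded (U i)" "\<And>i. i \<in> I \<Longrightarrow> diameter (U i) \<le> d"
  shows "hausdorff_content k \<delta> E \<le> ennreal (real (card I) * (unit_ball_vol (real k) * (d / 2) ^ k))"
proof -
  obtain h where h: "bij_betw h {..<card I} I"
    using ex_bij_betw_nat_finite[OF I] by (auto simp: atLeast0LessThan)
  \<comment> \<open>The empty sets that pad the finite cover to a sequence have weight 0, even for
    \<open>k = 0\<close>.\<close>
  define V where "V n = (if n < card I then U (h n) else {})" for n
  have "hausdorff_content k \<delta> E \<le> (\<Sum>n. hausdorff_weight k (V n))"
  proof (rule hausdorff_content_upper)
    show "E \<subseteq> (\<Union>n. V n)"
    proof
      fix x assume "x \<in> E"
      then obtain i where i: "i \<in> I" "x \<in> U i" using E by blast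
      have "i \<in> h ` {..<card I}" using i(1) bij_betw_imp_surj_on[OF h] by simp
      then obtain n where "n < card I" "h n = i" by auto
      then show "x \<in> (\<Union>n. V n)" using i by (auto simp: V_def intro!: UN_I[of n])
    qed
    fix n
    have "n < card I \<Longrightarrow> h n \<in> I" using h by (auto simp: bij_betw_def)
    then show "bounded (V n)" "diameter (V n) \<le> \<delta>" using U d by (fastforce simp: V_def)+
  qed
  also have "\<dots> = (\<Sum>n<card I. hausdorff_weight k (V n))"
    by (rule suminf_finite) (auto simp: V_def hausdorff_weight_def)
  also have "\<dots> \<le> (\<Sum>n<card I. ennreal (unit_ball_vol (real k) * (d / 2) ^ k))"
  proof (rule sum_mono)
    fix n assume n: "n \<in> {..<card I}"
    then have "h n \<in> I" using h by (auto simp: bij_betw_def)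
    then have "unit_ball_vol (real k) * (diameter (V n) / 2) ^ k \<le> unit_ball_vol (real k) * (d / 2) ^ k"
      using n U diameter_ge_0[of "U (h n)"]
      by (intro mult_left_mono power_mono divide_right_mono) (auto simp: V_def)
    then show "hausdorff_weight k (V n) \<le> ennreal (unit_ball_vol (real k) * (d / 2) ^ k)"
      by (auto simp: hausdorff_weight_def intro: ennreal_leI)
  qed
  also have "\<dots> = ennreal (real (card I) * (unit_ball_vol (real k) * (d / 2) ^ k))"
    using d by (simp add: ennreal_mult ennreal_of_nat_eq_real_of_nat)
  finally show ?thesis .
qed

text \<open>A grid of mesh \<open>1 / n\<close> has \<open>(n + 1) ^ k\<close> cells of diameter at
  most \<open>k / n\<close>. As \<open>n + 1\<close> is at most \<open>2 * n\<close>, their total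
  weight is at most the volume of the unit ball times \<open>k ^ k\<close>, whatever the scale. The
  cube serves as the model set of its dimension: similarities carry its measure estimates to all
  affine subspaces.\<close>

lemma hausdorff_coord_cube_finite:
  fixes J :: "'a::euclidean_space set"
  assumes J: "J \<subseteq> Basis"
  shows "hausdorff_outer_measure (card J) (coord_cube J) < \<top>"
proof -
  let ?k = "card J" and ?\<omega> = "unit_ball_vol (real (card J))"
  have fJ: "finite J" using J finite_Basis finite_subset by blast
  have "hausdorff_content ?k \<delta> (coord_cube J) \<le> ennreal (?\<omega> * real ?k ^ ?k)" if \<delta>: "0 < \<delta>" for \<delta>
  proof -
    obtain n :: nat where n: "0 < n" "real ?k / real n \<le> \<delta>"
    proof -
      obtain n :: nat where "real ?k / \<delta> < real n" using reals_Archimedean2 by blast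
      then show thesis using that[of "Suc n"] \<delta> by (auto simp: field_simps)
    qed
    \<comment> \<open>The index \<open>n\<close> itself belongs to the range, because the coordinate
      1 is rounded down to it.\<close>
    define I where "I = (PiE J (\<lambda>_. {..n}))"
    define U :: "('a \<Rightarrow> nat) \<Rightarrow> 'a set" where
      "U p = {y. \<forall>b\<in>Basis. if b \<in> J then real (p b) / n \<le> y \<bullet> b \<and> y \<bullet> b \<le> (real (p b) + 1) / n else y \<bullet> b = 0}" for p
    have dist: "dist x y \<le> real ?k / n" if "x \<in> U p" "y \<in> U p" for x y p
    proof -
      have "norm (x - y) \<le> real ?k * (1 / n)"
      proof (rule norm_le_on_coordinates[OF J])
        fix b assume b: "b \<in> J"
        then have "b \<in> Basis" using J by blast
        then have "x \<bullet> b - y \<bullet> b \<le> (real (p b) + 1) / n - real (p b) / n"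
             "y \<bullet> b - x \<bullet> b \<le> (real (p b) + 1) / n - real (p b) / n"
          using that b unfolding U_def by (auto intro!: diff_mono)
        then show "\<bar>(x - y) \<bullet> b\<bar> \<le> 1 / n" by (simp add: inner_diff_left add_divide_distrib)
      next
        fix b assume b: "b \<in> Basis - J"
        then show "(x - y) \<bullet> b = 0" using that unfolding U_def by (fastforce simp: inner_diff_left)
      qed
      then show ?thesis by (simp add: dist_norm)
    qed
    have "hausdorff_content ?k \<delta> (coord_cube J)
        \<le> ennreal (real (card I) * (?\<omega> * (real ?k / n / 2) ^ ?k))"
    proof (rule hausdorff_content_finite_cover)
      show "finite I" using fJ by (auto simp: I_def intro: finite_PiE)
      show "coord_cube J \<subseteq> (\<Union>p\<in>I. U p)"
      proof
        fix y assume y: "y \<in> coord_cube J"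
        define p where "p = restrict (\<lambda>b. nat \<lfloor>y \<bullet> b * n\<rfloor>) J"
        have y01: "0 \<le> y \<bullet> b" "y \<bullet> b \<le> 1" if "b \<in> J" for b
          using y that J by (auto simp: coord_cube_def subset_iff)
        have "\<lfloor>y \<bullet> b * n\<rfloor> \<le> int n" if "b \<in> J" for b
        proof -
          have "y \<bullet> b * n \<le> 1 * real n" using y01[OF that] by (intro mult_right_mono) auto
          then show ?thesis by linarith
        qed
        then have "p \<in> I" by (auto simp: p_def I_def nat_le_iff)
        moreover have "y \<in> U p"
        proof -
          have "real (p b) / n \<le> y \<bullet> b \<and> y \<bullet> b \<le> (real (p b) + 1) / n" if "b \<in> J" for b
          proof -
            have "real (p b) = of_int \<lfloor>y \<bullet> b * n\<rfloor>" using that y01 by (simp add: p_def)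
            then have "real (p b) \<le> y \<bullet> b * n" "y \<bullet> b * n \<le> real (p b) + 1" by linarith+
            then show ?thesis using n by (simp add: field_simps)
          qed
          then show ?thesis using y by (auto simp: U_def coord_cube_def)
        qed
        ultimately show "y \<in> (\<Union>p\<in>I. U p)" by blast
      qed
      show "bounded (U p)" for p
        unfolding bounded_def using dist[of _ p] by (cases "U p = {}") blast+
      show "diameter (U p) \<le> real ?k / n" for p
        using dist[of _ p] by (intro diameter_le) (auto simp: dist_norm)
    qed (use n in auto)
    also have "\<dots> \<le> ennreal (?\<omega> * real ?k ^ ?k)"
    proof (rule ennreal_leI)
      have "real (card I) = (real n + 1) ^ ?k" using fJ by (simp add: I_def card_PiE add.commute)
      then have "real (card I) * (?\<omega> * (real ?k / n / 2) ^ ?k) = ?\<omega> * ((real n + 1) * (real ?k / n / 2)) ^ ?k"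
        by (simp only: power_mult_distrib mult_ac)
      also have "\<dots> \<le> ?\<omega> * real ?k ^ ?k"
        using n mult_right_mono[of 1 "real n" "real ?k"]
        by (intro mult_left_mono power_mono) (auto simp: field_simps)
      finally show "real (card I) * (?\<omega> * (real ?k / n / 2) ^ ?k) \<le> ?\<omega> * real ?k ^ ?k" .
    qed
    finally show ?thesis .
  qed
  then have "hausdorff_outer_measure ?k (coord_cube J) \<le> ennreal (?\<omega> * real ?k ^ ?k)"
    unfolding hausdorff_outer_measure_def by (auto intro!: SUP_least)
  then show ?thesis by (rule le_less_trans) simp
qed

text \<open>Thickening a cover of the cube by unit intervals in the remaining coordinates gives boxes that
  cover the full unit cube, whose Lebesgue measure is 1.\<close>

lemma hausdorff_coord_cube_pos:
  fixes J :: "'a::euclidean_space set"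
  assumes J: "J \<subseteq> Basis"
  shows "0 < hausdorff_outer_measure (card J) (coord_cube J)"
proof -
  let ?k = "card J" and ?\<omega> = "unit_ball_vol (real (card J))"
  have fJ: "finite J" using J finite_Basis finite_subset by blast
  have \<omega>: "0 < ?\<omega>" by simp
  \<comment> \<open>The content at one scale is enough for a lower bound. The constant is the ratio
    of the weight of a set of diameter \<open>r\<close> to the volume \<open>(2 * r) ^ k\<close> of
    its box.\<close>
  have "ennreal (?\<omega> / 4 ^ ?k) \<le> hausdorff_content ?k 1 (coord_cube J)"
  proof (rule hausdorff_content_greatest)
    fix U :: "nat \<Rightarrow> 'a set"
    assume U: "coord_cube J \<subseteq> (\<Union>i. U i)" "\<And>i. bounded (U i)" "\<And>i. diameter (U i) \<le> 1"
    \<comment> \<open>The box around a point \<open>q i\<close> of \<open>U i\<close> reaches one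
      diameter to either side in the coordinates in \<open>J\<close>, so it contains the points of
      the full cube whose projection lies in \<open>U i\<close>.\<close>
    define q where "q i = (SOME y. y \<in> U i)" for i
    define lo where "lo i = (\<Sum>b\<in>Basis. (if b \<in> J then q i \<bullet> b - diameter (U i) else 0) *\<^sub>R b)" for i
    define hi where "hi i = (\<Sum>b\<in>Basis. (if b \<in> J then q i \<bullet> b + diameter (U i) else 1) *\<^sub>R b)" for i
    define W where "W i = (if U i = {} then {} else cbox (lo i) (hi i))" for i
    have lo: "lo i \<bullet> b = (if b \<in> J then q i \<bullet> b - diameter (U i) else 0)" if "b \<in> Basis" for b i
      using that by (simp add: lo_def)
    have hi: "hi i \<bullet> b = (if b \<in> J then q i \<bullet> b + diameter (U i) else 1)" if "b \<in> Basis" for b i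
      using that by (simp add: hi_def)
    have dn: "0 \<le> diameter (U i)" for i using U(2) by (rule diameter_ge_0)
    have W: "emeasure lborel (W i) \<le> ennreal (4 ^ ?k / ?\<omega>) * hausdorff_weight ?k (U i)" for i
    proof (cases "U i = {}")
      case False
      have "emeasure lborel (W i) = ennreal (\<Prod>b\<in>Basis. (hi i - lo i) \<bullet> b)"
        using False dn[of i] unfolding W_def by (simp add: lo hi)
      also have "(\<Prod>b\<in>Basis. (hi i - lo i) \<bullet> b) = (\<Prod>b\<in>Basis. if b \<in> J then 2 * diameter (U i) else 1)"
        by (intro prod.cong) (auto simp: lo hi inner_diff_left)
      also have "\<dots> = (\<Prod>b\<in>J. 2 * diameter (U i))"
        using J by (simp add: prod.If_cases Int_absorb1)
      also have "\<dots> = (4 ^ ?k / ?\<omega>) * (?\<omega> * (diameter (U i) / 2) ^ ?k)"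
      proof -
        have "2 * diameter (U i) = 4 * (diameter (U i) / 2)" by simp
        then have "(2 * diameter (U i)) ^ ?k = 4 ^ ?k * (diameter (U i) / 2) ^ ?k"
          by (simp only: power_mult_distrib)
        then show ?thesis using \<omega> by (simp del: unit_ball_vol_pos)
      qed
      finally show ?thesis using False less_imp_neq[OF \<omega>, symmetric] dn[of i] by (simp add: hausdorff_weight_def ennreal_mult[symmetric])
    qed (simp add: W_def)
    have "cbox 0 One \<subseteq> (\<Union>i. W i)"
    proof
      fix y :: 'a assume y: "y \<in> cbox 0 One"
      \<comment> \<open>The projection of \<open>y\<close> to the coordinates in \<open>J\<close>;
        it lies in the smaller cube, so some \<open>U i\<close> contains it.\<close>
      define y' where "y' = (\<Sum>b\<in>Basis. (if b \<in> J then y \<bullet> b else 0) *\<^sub>R b)"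
      have y': "y' \<bullet> b = (if b \<in> J then y \<bullet> b else 0)" if "b \<in> Basis" for b
        using that by (simp add: y'_def)
      have "y' \<in> coord_cube J" using y by (auto simp: coord_cube_def y' mem_box)
      then obtain i where i: "y' \<in> U i" using U(1) by blast
      then have "q i \<in> U i" unfolding q_def by (rule someI)
      then have "norm (y' - q i) \<le> diameter (U i)"
        using diameter_bounded_bound[OF U(2) i] by (simp add: dist_norm)
      then have "\<bar>(y' - q i) \<bullet> b\<bar> \<le> diameter (U i)" if "b \<in> Basis" for b
        using Basis_le_norm[OF that, of "y' - q i"] by linarith
      then have "y \<in> cbox (lo i) (hi i)"
        using y J by (force simp: mem_box lo hi y' inner_diff_left abs_le_iff)
      then show "y \<in> (\<Union>i. W i)" using i by (auto simp: W_def intro!: UN_I[of i])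
    qed
    then have "emeasure lborel (cbox 0 One :: 'a set) \<le> emeasure lborel (\<Union>i. W i)"
      by (intro emeasure_mono) (auto simp: W_def)
    also have "\<dots> \<le> (\<Sum>i. emeasure lborel (W i))"
      by (rule emeasure_subadditive_countably) (auto simp: W_def)
    also have "\<dots> \<le> (\<Sum>i. ennreal (4 ^ ?k / ?\<omega>) * hausdorff_weight ?k (U i))"
      by (intro suminf_le W) auto
    finally have one: "1 \<le> ennreal (4 ^ ?k / ?\<omega>) * (\<Sum>i. hausdorff_weight ?k (U i))" by simp
    have "ennreal (?\<omega> / 4 ^ ?k) * 1 \<le> ennreal (?\<omega> / 4 ^ ?k) * (ennreal (4 ^ ?k / ?\<omega>) * (\<Sum>i. hausdorff_weight ?k (U i)))"
      by (rule mult_left_mono[OF one]) simp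
    also have "\<dots> = (\<Sum>i. hausdorff_weight ?k (U i))"
      using \<omega> by (simp add: mult.assoc[symmetric] ennreal_mult[symmetric] del: unit_ball_vol_pos)
    finally show "ennreal (?\<omega> / 4 ^ ?k) \<le> (\<Sum>i. hausdorff_weight ?k (U i))" by simp
  qed
  also have "\<dots> \<le> hausdorff_outer_measure ?k (coord_cube J)"
    by (rule hausdorff_content_le_outer) simp
  finally have le: "ennreal (?\<omega> / 4 ^ ?k) \<le> hausdorff_outer_measure ?k (coord_cube J)" .
  have "0 < ennreal (?\<omega> / 4 ^ ?k)" using \<omega> by simp
  then show ?thesis using le by (rule less_le_trans)
qed

section \<open>Hausdorff measure on affine subspaces\<close>

definition direction :: "'a::real_vector set \<Rightarrow> 'a set" where
  "direction S = span {x - y | x y. x \<in> S \<and> y \<in> S}"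

lemma subspace_direction [simp]: "subspace (direction S)"
  by (simp add: direction_def)

lemma diff_mem_direction: "x \<in> S \<Longrightarrow> y \<in> S \<Longrightarrow> x - y \<in> direction S"
  unfolding direction_def by (rule span_base) auto

lemma direction_eq_span:
  assumes "a \<in> S" shows "direction S = span ((\<lambda>x. - a + x) ` S)"
  unfolding direction_def
proof (rule span_eq[THEN iffD2], intro conjI subsetI)
  fix v assume "v \<in> {x - y | x y. x \<in> S \<and> y \<in> S}"
  then obtain x y where "x \<in> S" "y \<in> S" and v: "v = (- a + x) - (- a + y)" by auto
  then show "v \<in> span ((\<lambda>x. - a + x) ` S)" unfolding v by (intro span_diff span_base) auto
next
  fix v assume "v \<in> (\<lambda>x. - a + x) ` S"
  then obtain x where "x \<in> S" "v = x - a" by auto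
  then show "v \<in> span {x - y | x y. x \<in> S \<and> y \<in> S}" using assms by (intro span_base) auto
qed

lemma affine_hull_eq_direction:
  "a \<in> S \<Longrightarrow> affine hull S = (\<lambda>v. a + v) ` direction S"
  by (simp add: direction_eq_span affine_hull_span_gen[of a S] hull_inc)

lemma dim_direction:
  assumes "S \<noteq> {}" shows "dim (direction S) = adim S"
proof -
  obtain a where "a \<in> S" using assms by blast
  then show ?thesis by (simp add: direction_eq_span adim_def aff_dim_eq_dim[of a S] hull_inc)
qed

lemma mem_affine_hull_iff:
  assumes "a \<in> S" shows "y \<in> affine hull S \<longleftrightarrow> y - a \<in> direction S"
  unfolding affine_hull_eq_direction[OF assms] by (auto simp: image_iff) (metis add_diff_cancel_left' add.commute diff_add_cancel)

text \<open>Subspaces of equal dimension are isometric; the model is spanned by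
  \<open>adim S\<close> many vectors of the standard basis, where the coordinate cube lives.\<close>

lemma obtain_coordinates:
  fixes S :: "'a::euclidean_space set"
  assumes "S \<noteq> {}"
  obtains J :: "'a set" and f g :: "'a \<Rightarrow> 'a" where
    "J \<subseteq> Basis" "card J = adim S" "linear f" "linear g"
    "f ` direction S = span J" "g ` span J = direction S"
    "\<And>x. x \<in> direction S \<Longrightarrow> norm (f x) = norm x" "\<And>x. x \<in> span J \<Longrightarrow> norm (g x) = norm x"
    "\<And>x. x \<in> direction S \<Longrightarrow> g (f x) = x" "\<And>x. x \<in> span J \<Longrightarrow> f (g x) = x"
proof -
  have "adim S \<le> card (Basis :: 'a set)"
    using dim_subset_UNIV[of "direction S"] dim_direction[OF assms] by simp
  then obtain J :: "'a set" where J: "J \<subseteq> Basis" "card J = adim S" using ex_card by blast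
  have "dim (span J) = card J"
    unfolding span_substd_basis[OF J(1)] by (rule dim_substandard[OF J(1)])
  then have "dim (direction S) = dim (span J)" using J dim_direction[OF assms] by simp
  from isometries_subspaces[OF subspace_direction subspace_span this] show thesis
    using that[OF J] by metis
qed

text \<open>A bounded part of the affine hull lies in a similar copy of the coordinate cube, and
  similarities are Lipschitz.\<close>

lemma hausdorff_outer_bounded_finite:
  fixes S :: "'a::euclidean_space set"
  assumes S: "S \<noteq> {}" and E: "E \<subseteq> affine hull S" "bounded E"
  shows "hausdorff_outer_measure (adim S) E < \<top>"
proof -
  obtain a where a: "a \<in> S" using S by blast
  obtain J :: "'a set" and f g :: "'a \<Rightarrow> 'a" where J: "J \<subseteq> Basis" "card J = adim S"
    and lin: "linear f" "linear g" and im: "f ` direction S = span J" "g ` span J = direction S"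
    and nf: "\<And>x. x \<in> direction S \<Longrightarrow> norm (f x) = norm x"
    and ng: "\<And>x. x \<in> span J \<Longrightarrow> norm (g x) = norm x"
    and gf: "\<And>x. x \<in> direction S \<Longrightarrow> g (f x) = x"
    by (rule obtain_coordinates[OF S]) blast
  interpret f: linear f by (rule lin)
  interpret g: linear g by (rule lin)
  obtain M where M: "0 < M" "\<And>x. x \<in> E \<Longrightarrow> norm (x - a) \<le> M"
    using E(2) bounded_pos[of "(\<lambda>x. x - a) ` E"] bounded_translation_minus[of E a] by auto
  \<comment> \<open>The similarity that centres the unit cube at \<open>a\<close> and stretches it
    to side \<open>2 * M\<close>; half the sum of \<open>J\<close> is the centre of the
    cube.\<close>
  define h where "h c = a + g ((2 * M) *\<^sub>R (c - (1 / 2) *\<^sub>R (\<Sum>b\<in>J. b)))" for c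
  have center: "(\<Sum>b\<in>J. b) \<bullet> b = (if b \<in> J then 1 else 0)" if "b \<in> Basis" for b
    using J(1) that finite_subset[OF J(1) finite_Basis]
    by (auto simp: inner_sum_left inner_Basis subset_iff sum.If_cases Int_def intro!: sum.neutral)
  have "E \<subseteq> h ` coord_cube J"
  proof
    fix x assume x: "x \<in> E"
    then have d: "x - a \<in> direction S" using E(1) mem_affine_hull_iff[OF a] by blast
    define c where "c = (1 / (2 * M)) *\<^sub>R f (x - a) + (1 / 2) *\<^sub>R (\<Sum>b\<in>J. b)"
    have "x = h c"
      using M(1) gf[OF d] by (simp add: h_def c_def)
    moreover have "c \<in> coord_cube J"
    proof -
      have "f (x - a) \<in> span J" using d im(1) by blast
      then have out: "f (x - a) \<bullet> b = 0" if "b \<in> Basis" "b \<notin> J" for b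
        using that unfolding span_substd_basis[OF J(1)] by blast
      have "\<bar>f (x - a) \<bullet> b\<bar> \<le> M" if "b \<in> Basis" for b
        using Basis_le_norm[OF that, of "f (x - a)"] nf[OF d] M(2)[OF x] by linarith
      then have "0 \<le> c \<bullet> b \<and> c \<bullet> b \<le> 1" if "b \<in> J" "b \<in> Basis" for b
        using that M(1) by (simp add: c_def inner_add_left center field_simps abs_le_iff)
          (smt (verit, best))
      then show ?thesis using J(1)
        by (auto simp: coord_cube_def c_def inner_add_left center out)
    qed
    ultimately show "x \<in> h ` coord_cube J" by blast
  qed
  then have "hausdorff_outer_measure (adim S) E \<le> hausdorff_outer_measure (adim S) (h ` coord_cube J)"
    by (rule hausdorff_outer_mono)
  also have "\<dots> \<le> ennreal ((2 * M) ^ adim S) * hausdorff_outer_measure (adim S) (coord_cube J)"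
  proof (rule hausdorff_outer_lipschitz)
    fix x y assume "x \<in> coord_cube J" "y \<in> coord_cube J"
    then have "x - y \<in> span J" using coord_cube_subset_span[OF J(1)] by (auto intro: span_diff)
    then have "norm (g (x - y)) = norm (x - y)" by (rule ng)
    moreover have "h x - h y = (2 * M) *\<^sub>R g (x - y)"
      by (simp add: h_def g.diff g.scaleR algebra_simps)
    ultimately show "dist (h x) (h y) \<le> 2 * M * dist x y"
      using M(1) by (simp add: dist_norm)
  qed (use M in simp)
  also have "\<dots> < \<top>"
    using hausdorff_coord_cube_finite[OF J(1)] J(2) by (simp add: ennreal_mult_less_top)
  finally show ?thesis .
qed

text \<open>A nonempty convex set contains a ball of its affine hull, hence a small copy of the
  coordinate cube. Blowing that copy up is Lipschitz, so measure zero of the set would force measure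
  zero of the cube.\<close>

lemma hausdorff_outer_convex_pos:
  fixes S :: "'a::euclidean_space set"
  assumes S: "S \<noteq> {}" "convex S"
  shows "0 < hausdorff_outer_measure (adim S) S"
proof -
  obtain a where "a \<in> rel_interior S" using S rel_interior_eq_empty by blast
  then obtain e where a: "a \<in> S" and e: "0 < e" "cball a e \<inter> affine hull S \<subseteq> S"
    using mem_rel_interior_cball by blast
  obtain J :: "'a set" and f g :: "'a \<Rightarrow> 'a" where J: "J \<subseteq> Basis" "card J = adim S"
    and lin: "linear f" "linear g" and im: "f ` direction S = span J" "g ` span J = direction S"
    and nf: "\<And>x. x \<in> direction S \<Longrightarrow> norm (f x) = norm x"
    and ng: "\<And>x. x \<in> span J \<Longrightarrow> norm (g x) = norm x"
    and gf: "\<And>x. x \<in> direction S \<Longrightarrow> g (f x) = x"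
    and fg: "\<And>x. x \<in> span J \<Longrightarrow> f (g x) = x"
    by (rule obtain_coordinates[OF S(1)]) blast
  interpret f: linear f by (rule lin)
  interpret g: linear g by (rule lin)
  \<comment> \<open>Points of the cube have norm at most \<open>card J\<close>, so the cube scaled
    by \<open>r\<close> fits into the ball of radius \<open>e\<close>. The summand 1 keeps
    \<open>r\<close> defined when \<open>J\<close> is empty.\<close>
  define r where "r = e / (1 + real (card J))"
  have r: "0 < r" "real (card J) * r \<le> e" using e by (auto simp: r_def field_simps)
  define h where "h y = (1 / r) *\<^sub>R f (y - a)" for y
  have "coord_cube J \<subseteq> h ` S"
  proof
    fix c assume c: "c \<in> coord_cube J"
    then have cJ: "c \<in> span J" using coord_cube_subset_span[OF J(1)] by blast
    have "norm c \<le> real (card J) * 1"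
      using c J(1) by (intro norm_le_on_coordinates) (auto simp: coord_cube_def subset_iff)
    then have "r * norm c \<le> r * (real (card J) * 1)" using r by (intro mult_left_mono) auto
    also have "\<dots> \<le> e" using r by (simp add: mult.commute)
    finally have "r * norm c \<le> e" .
    then have "a + r *\<^sub>R g c \<in> cball a e"
      using r ng[OF cJ] by (simp add: dist_norm)
    moreover have "r *\<^sub>R g c \<in> direction S" using cJ im(2) by (intro subspace_scale subspace_direction) blast
    then have "a + r *\<^sub>R g c \<in> affine hull S" using mem_affine_hull_iff[OF a] by simp
    ultimately have "a + r *\<^sub>R g c \<in> S" using e by blast
    moreover have "h (a + r *\<^sub>R g c) = c" using r fg[OF cJ] by (simp add: h_def f.scaleR)
    ultimately show "c \<in> h ` S" by (metis imageI)
  qed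
  then have "hausdorff_outer_measure (adim S) (coord_cube J) \<le> hausdorff_outer_measure (adim S) (h ` S)"
    by (rule hausdorff_outer_mono)
  also have "\<dots> \<le> ennreal ((1 / r) ^ adim S) * hausdorff_outer_measure (adim S) S"
  proof (rule hausdorff_outer_lipschitz)
    fix x y assume "x \<in> S" "y \<in> S"
    then have "norm (f (x - y)) = norm (x - y)" by (intro nf diff_mem_direction)
    moreover have "h x - h y = (1 / r) *\<^sub>R f (x - y)"
      by (simp add: h_def f.diff algebra_simps)
    ultimately show "dist (h x) (h y) \<le> 1 / r * dist x y"
      using r by (simp add: dist_norm)
  qed (use r in simp)
  finally show ?thesis
    using hausdorff_coord_cube_pos[OF J(1)] J(2) by (auto simp: zero_less_iff_neq_zero)
qed

section \<open>Null relative frontiers\<close>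

lemma borel_in_sets_hausdorff: "A \<in> sets borel \<Longrightarrow> A \<in> sets (hausdorff_measure k)"
  using borel_subset_sets_hausdorff by blast

lemma emeasure_hausdorff_borel:
  "A \<in> sets borel \<Longrightarrow> emeasure (hausdorff_measure k) A = hausdorff_outer_measure k A"
  by (intro emeasure_hausdorff_measure borel_in_sets_hausdorff)

lemma borel_rel_interior [measurable]: "rel_interior S \<in> sets (borel :: 'a::euclidean_space measure)"
proof -
  obtain T where "open T" "rel_interior S = affine hull S \<inter> T"
    using openin_rel_interior[of S] by (auto simp: openin_open)
  then show ?thesis by (auto intro!: sets.Int borel_closed closed_affine_hull borel_open)
qed

text \<open>Shrinking towards an interior point moves all of the set into its relative interior, at the
  price of a factor arbitrarily close to 1.\<close>

lemma hausdorff_rel_frontier_null: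
  fixes S :: "'a::euclidean_space set"
  assumes S: "S \<noteq> {}" "convex S" "compact S"
  shows "hausdorff_outer_measure (adim S) (S - rel_interior S) = 0"
proof -
  let ?k = "adim S"
  obtain a where a: "a \<in> rel_interior S" using S rel_interior_eq_empty by blast
  have fin: "hausdorff_outer_measure ?k E < \<top>" if "E \<subseteq> S" for E
    using that S hull_subset[of S affine]
    by (intro hausdorff_outer_bounded_finite) (auto intro: bounded_subset compact_imp_bounded)
  have sub: "rel_interior S \<subseteq> S" by (rule rel_interior_subset)
  have le: "hausdorff_outer_measure ?k S \<le> ennreal (C ^ ?k) * hausdorff_outer_measure ?k (rel_interior S)"
    if C: "1 < C" for C :: real
  proof -
    define h where "h y = a + C *\<^sub>R (y - a)" for y
    have "S \<subseteq> h ` rel_interior S"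
    proof
      fix x assume x: "x \<in> S"
      \<comment> \<open>This is the image of \<open>x\<close> under the homothety with centre
        \<open>a\<close> and ratio \<open>1 / C\<close>, the inverse of \<open>h\<close>.\<close>
      have "x - (1 - 1 / C) *\<^sub>R (x - a) \<in> rel_interior S"
        using C by (intro rel_interior_convex_shrink S a x) auto
      moreover have "h (x - (1 - 1 / C) *\<^sub>R (x - a)) = x"
      proof -
        have "x - (1 - 1 / C) *\<^sub>R (x - a) - a = (1 / C) *\<^sub>R (x - a)" by (simp add: algebra_simps)
        then show ?thesis using C by (simp add: h_def)
      qed
      ultimately show "x \<in> h ` rel_interior S" by (metis imageI)
    qed
    then have "hausdorff_outer_measure ?k S \<le> hausdorff_outer_measure ?k (h ` rel_interior S)"
      by (rule hausdorff_outer_mono)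
    also have "\<dots> \<le> ennreal (C ^ ?k) * hausdorff_outer_measure ?k (rel_interior S)"
    proof (rule hausdorff_outer_lipschitz)
      fix x y
      have "h x - h y = C *\<^sub>R (x - y)" by (simp add: h_def algebra_simps)
      then show "dist (h x) (h y) \<le> C * dist x y" using C by (simp add: dist_norm)
    qed (use C in simp)
    finally show ?thesis .
  qed
  \<comment> \<open>Both measures are finite, so the factor \<open>C ^ k\<close> can be sent to 1
    among real numbers and the measures can be subtracted.\<close>
  define m n where "m = enn2real (hausdorff_outer_measure ?k S)"
    and "n = enn2real (hausdorff_outer_measure ?k (rel_interior S))"
  have m: "hausdorff_outer_measure ?k S = ennreal m" and n: "hausdorff_outer_measure ?k (rel_interior S) = ennreal n"
    using fin[of S] fin[OF sub] by (auto simp: m_def n_def)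
  have n0: "0 \<le> n" by (simp add: n_def)
  have "m \<le> n"
  proof (rule LIMSEQ_le_const)
    have "(\<lambda>i. (1 + 1 / real (Suc i)) ^ ?k * n) \<longlonglongrightarrow> (1 + 0) ^ ?k * n"
      by (intro tendsto_intros LIMSEQ_inverse_real_of_nat[unfolded inverse_eq_divide])
    then show "(\<lambda>i. (1 + 1 / real (Suc i)) ^ ?k * n) \<longlonglongrightarrow> n" by simp
    have "m \<le> (1 + 1 / real (Suc i)) ^ ?k * n" for i
      using le[of "1 + 1 / real (Suc i)"] n0 unfolding m n by (simp add: ennreal_mult[symmetric])
    then show "\<exists>N. \<forall>i\<ge>N. m \<le> (1 + 1 / real (Suc i)) ^ ?k * n" by blast
  qed
  have borel: "S \<in> sets borel" using S by (simp add: borel_compact)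
  have "hausdorff_outer_measure ?k (S - rel_interior S) = emeasure (hausdorff_measure ?k) (S - rel_interior S)"
    using borel by (intro emeasure_hausdorff_borel[symmetric]) auto
  also have "\<dots> = emeasure (hausdorff_measure ?k) S - emeasure (hausdorff_measure ?k) (rel_interior S)"
    using borel fin[OF sub] sub
    by (intro emeasure_Diff) (auto simp: emeasure_hausdorff_borel borel_in_sets_hausdorff less_top)
  also have "\<dots> = ennreal m - ennreal n" using borel by (simp add: emeasure_hausdorff_borel m n)
  also have "\<dots> = 0" using \<open>m \<le> n\<close> n0 by (simp add: ennreal_minus ennreal_neg)
  finally show ?thesis .
qed

text \<open>The push-forward along the identity cuts the Caratheodory sets down to the Borel sets,
  so product measures and measurability stay within \<open>borel\<close>. The density confines the
  mass to \<open>V\<close> while the space remains \<open>UNIV\<close>, so translations are defined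
  everywhere.\<close>

definition hausdorff_on :: "nat \<Rightarrow> 'a::metric_space set \<Rightarrow> 'a measure" where
  "hausdorff_on k V = density (distr (hausdorff_measure k) borel (\<lambda>x. x)) (indicator V)"

lemma measurable_id_hausdorff [measurable]: "(\<lambda>x. x) \<in> measurable (hausdorff_measure k) borel"
  using borel_in_sets_hausdorff by (auto simp: measurable_def)

lemma sets_hausdorff_on [simp, measurable_cong]: "sets (hausdorff_on k V) = sets borel"
  by (simp add: hausdorff_on_def)

lemma space_hausdorff_on [simp]: "space (hausdorff_on k V) = UNIV"
  by (simp add: hausdorff_on_def)

lemma measurable_hausdorff_on [simp]: "measurable (hausdorff_on k V) N = measurable borel N"
  by (rule measurable_cong_sets) simp_all

lemma nn_integral_hausdorff_on:
  assumes "V \<in> sets borel" "f \<in> borel_measurable borel"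
  shows "(\<integral>\<^sup>+x. f x \<partial>hausdorff_on k V) = (\<integral>\<^sup>+x\<in>V. f x \<partial>hausdorff_measure k)"
proof -
  note [measurable] = assms
  show ?thesis unfolding hausdorff_on_def
    by (subst nn_integral_density) (simp_all add: nn_integral_distr mult.commute)
qed

lemma emeasure_hausdorff_on:
  assumes "V \<in> sets borel" "A \<in> sets borel"
  shows "emeasure (hausdorff_on k V) A = hausdorff_outer_measure k (A \<inter> V)"
proof -
  have "emeasure (hausdorff_on k V) A = (\<integral>\<^sup>+x. indicator A x \<partial>hausdorff_on k V)"
    using assms by simp
  also have "\<dots> = (\<integral>\<^sup>+x. indicator (A \<inter> V) x \<partial>hausdorff_measure k)"
    using assms by (simp add: nn_integral_hausdorff_on indicator_inter_arith del: nn_integral_indicator)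
  also have "\<dots> = hausdorff_outer_measure k (A \<inter> V)"
    using assms by (simp add: borel_in_sets_hausdorff emeasure_hausdorff_borel)
  finally show ?thesis .
qed

lemma hausdorff_outer_isometry:
  assumes "\<And>x y. dist (f x) (f y) = dist x y"
  shows "hausdorff_outer_measure k (f ` E) = hausdorff_outer_measure k E"
proof (rule antisym)
  show "hausdorff_outer_measure k (f ` E) \<le> hausdorff_outer_measure k E"
    using hausdorff_outer_lipschitz[of 1 E f k] assms by simp
  have inj: "inj f" using assms by (metis dist_eq_0_iff injI)
  have "hausdorff_outer_measure k (inv f ` f ` E) \<le> hausdorff_outer_measure k (f ` E)"
  proof -
    have "dist (inv f x) (inv f y) \<le> 1 * dist x y" if xy: "x \<in> f ` E" "y \<in> f ` E" for x y
    proof -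
      obtain u v where "x = f u" "y = f v" using xy by blast
      then show ?thesis using assms inj by simp
    qed
    then show ?thesis using hausdorff_outer_lipschitz[of 1 "f ` E" "inv f" k] by simp
  qed
  then show "hausdorff_outer_measure k E \<le> hausdorff_outer_measure k (f ` E)"
    using inj by (simp add: image_image)
qed

lemma nn_integral_hausdorff_on_isometry:
  assumes f: "\<And>x y. dist (f x) (f y) = dist x y" and [measurable]: "V \<in> sets borel" "f ` V \<in> sets borel"
    and [measurable]: "h \<in> borel_measurable borel"
  shows "(\<integral>\<^sup>+x. h (f x) \<partial>hausdorff_on k V) = (\<integral>\<^sup>+x. h x \<partial>hausdorff_on k (f ` V))"
proof -
  have "continuous_on UNIV f"
    unfolding continuous_on_iff using f by auto
  then have fm [measurable]: "f \<in> borel_measurable borel" by (rule borel_measurable_continuous_onI)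
  have "distr (hausdorff_on k V) borel f = hausdorff_on k (f ` V)"
  proof (rule measure_eqI)
    fix A assume "A \<in> sets (distr (hausdorff_on k V) borel f)"
    then have [measurable]: "A \<in> sets borel" by simp
    have "emeasure (distr (hausdorff_on k V) borel f) A = emeasure (hausdorff_on k V) (f -` A)"
      using fm by (subst emeasure_distr) simp_all
    also have "\<dots> = hausdorff_outer_measure k (f -` A \<inter> V)"
      using measurable_sets[of f borel borel A] by (intro emeasure_hausdorff_on) auto
    also have "\<dots> = hausdorff_outer_measure k (f ` (f -` A \<inter> V))"
      by (rule hausdorff_outer_isometry[OF f, symmetric])
    also have "f ` (f -` A \<inter> V) = A \<inter> f ` V" by auto
    also have "hausdorff_outer_measure k (A \<inter> f ` V) = emeasure (hausdorff_on k (f ` V)) A"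
      by (simp add: emeasure_hausdorff_on)
    finally show "emeasure (distr (hausdorff_on k V) borel f) A = emeasure (hausdorff_on k (f ` V)) A" .
  qed simp
  then show ?thesis
    using nn_integral_distr[of f "hausdorff_on k V" borel h] fm assms(4) by simp
qed

lemma sigma_finite_hausdorff_on:
  fixes V :: "'a::euclidean_space set"
  assumes V: "V \<in> sets borel" and fin: "\<And>r. hausdorff_outer_measure k (cball 0 r \<inter> V) < \<top>"
  shows "sigma_finite_measure (hausdorff_on k V)"
proof
  have "(\<Union>n. cball 0 (real n)) = (UNIV :: 'a set)"
    using real_arch_simple by (auto simp: mem_cball_0)
  then show "\<exists>A. countable A \<and> A \<subseteq> sets (hausdorff_on k V) \<and> \<Union> A = space (hausdorff_on k V)
      \<and> (\<forall>a\<in>A. emeasure (hausdorff_on k V) a \<noteq> \<infinity>)"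
    using V fin by (intro exI[of _ "range (\<lambda>n::nat. cball 0 (real n))"])
      (auto simp: emeasure_hausdorff_on less_top)
qed

section \<open>Lower semicontinuous functions\<close>

text \<open>The filter in the definition omits \<open>p\<close>, where the bound holds by
  assumption. With \<open>p\<close> restored, the bound can be pulled back along sequences that may
  take the value \<open>p\<close>.\<close>

lemma lower_semicontinuous_on_eventually:
  assumes "lower_semicontinuous_on T f" "p \<in> T" "t < f p" "(u \<longlongrightarrow> p) F"
  shows "\<forall>\<^sub>F n in F. u n \<in> T \<longrightarrow> t < f (u n)"
proof -
  have "\<forall>\<^sub>F z in at p within T. t < f z"
    using assms by (auto simp: lower_semicontinuous_on_def)
  then have "\<forall>\<^sub>F z in nhds p. z \<in> T \<longrightarrow> t < f z"
    unfolding eventually_at_filter by (rule eventually_mono) (use assms in auto)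
  then show ?thesis using assms(4) by (rule eventually_compose_filterlim)
qed

lemma lower_semicontinuous_on_section:
  assumes f: "lower_semicontinuous_on (D \<times> Y) f" and x: "x \<in> D"
  shows "lower_semicontinuous_on Y (\<lambda>y. f (x, y))"
  unfolding lower_semicontinuous_on_def
proof (intro ballI allI impI)
  fix y t assume "y \<in> Y" "t < f (x, y)"
  then have "\<forall>\<^sub>F z in at y within Y. (x, z) \<in> D \<times> Y \<longrightarrow> t < f (x, z)"
    using x by (intro lower_semicontinuous_on_eventually[OF f, of "(x, y)"] tendsto_intros) auto
  moreover have "\<forall>\<^sub>F z in at y within Y. z \<in> Y" by (simp add: eventually_at_filter)
  ultimately show "\<forall>\<^sub>F z in at y within Y. t < f (x, z)"
    by eventually_elim (use x in auto)
qed

lemma continuous_on_imp_lower_semicontinuous_on: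
  "continuous_on T f \<Longrightarrow> lower_semicontinuous_on T f"
  unfolding lower_semicontinuous_on_def continuous_on_def by (auto intro: order_tendstoD)

lemma lower_semicontinuous_on_mult:
  assumes f: "lower_semicontinuous_on T f" "\<And>p. p \<in> T \<Longrightarrow> 0 \<le> f p"
    and r: "continuous_on T r" "\<And>p. p \<in> T \<Longrightarrow> 0 < r p"
  shows "lower_semicontinuous_on T (\<lambda>p. f p * r p)"
  unfolding lower_semicontinuous_on_def
proof (intro ballI allI impI)
  fix p t assume p: "p \<in> T" and t: "t < f p * r p"
  have T: "\<forall>\<^sub>F z in at p within T. z \<in> T" by (simp add: eventually_at_filter)
  show "\<forall>\<^sub>F z in at p within T. t < f z * r z"
  proof (cases "t < 0")
    case True
    from T show ?thesis
    proof eventually_elim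
      case (elim z)
      then have "0 \<le> f z * r z" using f(2) r(2) by (simp add: less_imp_le)
      then show ?case using True by simp
    qed
  next
    case False
    have "t / r p < f p" using t r(2)[OF p] by (simp add: field_simps)
    \<comment> \<open>The intermediate value decouples the factors: \<open>f\<close> stays above
      \<open>s\<close> by semicontinuity, and \<open>s * r\<close> stays above \<open>t\<close> by
      continuity.\<close>
    then obtain s where s: "t / r p < s" "s < f p" using dense by blast
    have s0: "0 < s" using s(1) False r(2)[OF p] by (smt (verit) divide_nonneg_pos)
    have "t < s * r p" using s(1) r(2)[OF p] by (simp add: field_simps)
    moreover have "((\<lambda>z. s * r z) \<longlongrightarrow> s * r p) (at p within T)"
      using r(1) p by (intro tendsto_intros) (auto simp: continuous_on_def)
    ultimately have "\<forall>\<^sub>F z in at p within T. t < s * r z" by (rule order_tendstoD(1)[rotated])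
    moreover have "\<forall>\<^sub>F z in at p within T. s < f z"
      using f(1) p s(2) by (auto simp: lower_semicontinuous_on_def)
    ultimately show ?thesis using T
    proof eventually_elim
      case (elim z)
      then have "s * r z < f z * r z" using r(2) by (intro mult_strict_right_mono) auto
      then show ?case using elim by simp
    qed
  qed
qed

text \<open>Strict superlevel sets are relatively open in \<open>Y\<close>. The indicator then
  extends the function by 0 to the whole space, since nothing is known about \<open>f\<close> off
  \<open>Y\<close>.\<close>

lemma lower_semicontinuous_on_measurable:
  fixes f :: "'a::topological_space \<Rightarrow> real"
  assumes f: "lower_semicontinuous_on Y f" and C: "C \<in> sets borel" "C \<subseteq> Y" and Y: "Y \<in> sets borel"
  shows "(\<lambda>y. ennreal (f y) * indicator C y) \<in> borel_measurable borel"
proof -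
  have "f \<in> borel_measurable (restrict_space borel Y)"
    unfolding borel_measurable_iff_greater
  proof (intro allI)
    fix a
    define U where "U = \<Union>{V. open V \<and> V \<inter> Y \<subseteq> {y. a < f y}}"
    have "open U" by (auto simp: U_def)
    have "{w \<in> space (restrict_space borel Y). a < f w} = U \<inter> Y"
    proof (intro equalityI subsetI)
      fix y assume y: "y \<in> {w \<in> space (restrict_space borel Y). a < f w}"
      then have "y \<in> Y" "a < f y" by (simp_all add: space_restrict_space)
      then have "\<forall>\<^sub>F z in nhds y. z \<in> Y \<longrightarrow> a < f z"
        by (rule lower_semicontinuous_on_eventually[OF f _ _ filterlim_ident])
      then show "y \<in> U \<inter> Y" using y
        by (auto simp: eventually_nhds U_def space_restrict_space)
    qed (auto simp: U_def space_restrict_space)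
    moreover have "U \<inter> Y \<in> sets (restrict_space borel Y)"
      unfolding sets_restrict_space using \<open>open U\<close> by (intro image_eqI[of _ _ U]) auto
    ultimately show "{w \<in> space (restrict_space borel Y). a < f w} \<in> sets (restrict_space borel Y)"
      by simp
  qed
  then have "(\<lambda>y. ennreal (f y)) \<in> borel_measurable (restrict_space borel Y)" by measurable
  then have "(\<lambda>y. ennreal (f y) * indicator Y y) \<in> borel_measurable borel"
    using Y by (subst (asm) borel_measurable_restrict_space_iff_ennreal) auto
  then have "(\<lambda>y. (ennreal (f y) * indicator Y y) * indicator C y) \<in> borel_measurable borel"
    using C by measurable
  moreover have "(ennreal (f y) * indicator Y y) * indicator C y = ennreal (f y) * indicator C y" for y
    using C by (auto split: split_indicator)
  ultimately show ?thesis by simp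
qed

lemma lower_semicontinuous_on_subset:
  "lower_semicontinuous_on T f \<Longrightarrow> U \<subseteq> T \<Longrightarrow> lower_semicontinuous_on U f"
  unfolding lower_semicontinuous_on_def by (meson at_le filter_leD subsetD)

text \<open>Points with values below \<open>- n\<close> would cluster at some point of
  \<open>T\<close>, where semicontinuity bounds the values from below. The constant serves to make
  the cost nonnegative.\<close>

lemma lower_semicontinuous_on_compact_bounded_below:
  fixes f :: "'a::metric_space \<Rightarrow> real"
  assumes T: "compact T" and f: "lower_semicontinuous_on T f"
  obtains C where "0 \<le> C" "\<And>p. p \<in> T \<Longrightarrow> - C \<le> f p"
proof -
  have "\<exists>n::nat. \<forall>p\<in>T. - real n \<le> f p"
  proof (rule ccontr)
    assume "\<not> ?thesis"
    then have "\<forall>n. \<exists>p\<in>T. f p < - real n" by (auto simp: not_le)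
    then obtain p where p: "\<And>n. p n \<in> T" "\<And>n. f (p n) < - real n" by metis
    obtain q r where r: "q \<in> T" "strict_mono r" "(p \<circ> r) \<longlonglongrightarrow> q"
      using T p(1) unfolding compact_def by metis
    have "\<forall>\<^sub>F n in sequentially. (p \<circ> r) n \<in> T \<longrightarrow> f q - 1 < f ((p \<circ> r) n)"
      by (rule lower_semicontinuous_on_eventually[OF f r(1) _ r(3)]) simp
    moreover obtain N :: nat where "1 - f q \<le> real N" using real_arch_simple by blast
    then have "\<forall>\<^sub>F n in sequentially. 1 - f q \<le> real n"
      by (intro eventually_sequentiallyI[of N]) simp
    ultimately have "\<forall>\<^sub>F n::nat in sequentially. False"
    proof eventually_elim
      case (elim n)
      moreover have "n \<le> r n" using r(2) by (rule seq_suble)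
      ultimately show ?case using p(1)[of "r n"] p(2)[of "r n"] by simp
    qed
    then show False by simp
  qed
  then show thesis using that by (metis of_nat_0_le_iff)
qed

section \<open>Integrals over the values of a stable convex-valued map\<close>

lemma adim_direction: "S \<noteq> {} \<Longrightarrow> adim (direction S) = adim S" for S :: "'a::euclidean_space set"
  by (simp add: adim_def[of "direction S"] aff_dim_subspace dim_direction)

lemma affine_hull_subspace: "subspace L \<Longrightarrow> affine hull L = L"
  by (simp add: hull_same subspace_imp_affine)

lemma AE_hausdorff_on: "V \<in> sets borel \<Longrightarrow> AE x in hausdorff_on k V. x \<in> V"
  by (rule AE_I[of _ _ "- V"]) (auto simp: emeasure_hausdorff_on hausdorff_outer_empty)

lemma sigma_finite_hausdorff_on_affine_hull:
  fixes S :: "'a::euclidean_space set"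
  assumes "S \<noteq> {}" shows "sigma_finite_measure (hausdorff_on (adim S) (affine hull S))"
proof (rule sigma_finite_hausdorff_on)
  fix r :: real
  have "bounded (cball 0 r \<inter> affine hull S)" by (simp add: bounded_Int)
  then show "hausdorff_outer_measure (adim S) (cball 0 r \<inter> affine hull S) < \<top>"
    using assms by (intro hausdorff_outer_bounded_finite) auto
qed (simp add: borel_closed)

text \<open>Fubini, with a translation of the inner integral by \<open>l \<in> L\<close> in between.\<close>

lemma nn_integral_translation_swap:
  fixes q h :: "'a::euclidean_space \<Rightarrow> ennreal"
  assumes sf: "sigma_finite_measure (hausdorff_on j L)" "sigma_finite_measure (hausdorff_on k V)"
    and [measurable]: "L \<in> sets borel" "V \<in> sets borel" "q \<in> borel_measurable borel" "h \<in> borel_measurable borel"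
    and inv: "\<And>l. l \<in> L \<Longrightarrow> (\<lambda>y. y + l) ` V = V"
  shows "(\<integral>\<^sup>+y. q y * (\<integral>\<^sup>+l. h (y + l) \<partial>hausdorff_on j L) \<partial>hausdorff_on k V)
    = (\<integral>\<^sup>+y. h y * (\<integral>\<^sup>+l. q (y - l) \<partial>hausdorff_on j L) \<partial>hausdorff_on k V)"
proof -
  interpret L: sigma_finite_measure "hausdorff_on j L" by fact
  interpret V: sigma_finite_measure "hausdorff_on k V" by fact
  interpret P: pair_sigma_finite "hausdorff_on j L" "hausdorff_on k V" ..
  have pm: "sets (hausdorff_on j L \<Otimes>\<^sub>M hausdorff_on k V) = sets (borel \<Otimes>\<^sub>M borel)"
    by (intro sets_pair_measure_cong) simp_all
  have m1: "(\<lambda>(l, y). q y * h (y + l)) \<in> borel_measurable (hausdorff_on j L \<Otimes>\<^sub>M hausdorff_on k V)"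
    unfolding measurable_cong_sets[OF pm refl] by measurable
  have m2: "(\<lambda>(l, y). q (y - l) * h y) \<in> borel_measurable (hausdorff_on j L \<Otimes>\<^sub>M hausdorff_on k V)"
    unfolding measurable_cong_sets[OF pm refl] by measurable
  have "(\<integral>\<^sup>+y. q y * (\<integral>\<^sup>+l. h (y + l) \<partial>hausdorff_on j L) \<partial>hausdorff_on k V)
      = (\<integral>\<^sup>+y. \<integral>\<^sup>+l. q y * h (y + l) \<partial>hausdorff_on j L \<partial>hausdorff_on k V)"
    by (subst nn_integral_cmult) simp_all
  also have "\<dots> = (\<integral>\<^sup>+l. \<integral>\<^sup>+y. q y * h (y + l) \<partial>hausdorff_on k V \<partial>hausdorff_on j L)"
    by (rule P.Fubini'[OF m1])
  also have "\<dots> = (\<integral>\<^sup>+l. \<integral>\<^sup>+y. q (y - l) * h y \<partial>hausdorff_on k V \<partial>hausdorff_on j L)"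
  \<comment> \<open>Only translations by elements of \<open>L\<close> preserve \<open>V\<close>, and
    the outer measure gives no mass to the complement of \<open>L\<close>.\<close>
  proof (rule nn_integral_cong_AE)
    have "(\<integral>\<^sup>+y. q y * h (y + l) \<partial>hausdorff_on k V) = (\<integral>\<^sup>+y. q (y - l) * h y \<partial>hausdorff_on k V)"
      if "l \<in> L" for l
    proof -
      have "(\<lambda>y. q (y - l) * h y) \<in> borel_measurable borel" by measurable
      then have "(\<integral>\<^sup>+y. q (y + l - l) * h (y + l) \<partial>hausdorff_on k V)
          = (\<integral>\<^sup>+y. q (y - l) * h y \<partial>hausdorff_on k ((\<lambda>y. y + l) ` V))"
        by (intro nn_integral_hausdorff_on_isometry[of "\<lambda>y. y + l"]) (simp_all add: inv[OF that])
      then show ?thesis by (simp only: inv[OF that] add_diff_cancel_right')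
    qed
    then show "AE l in hausdorff_on j L. (\<integral>\<^sup>+y. q y * h (y + l) \<partial>hausdorff_on k V)
        = (\<integral>\<^sup>+y. q (y - l) * h y \<partial>hausdorff_on k V)"
      using AE_hausdorff_on[of L j] by auto
  qed
  also have "\<dots> = (\<integral>\<^sup>+y. \<integral>\<^sup>+l. h y * q (y - l) \<partial>hausdorff_on j L \<partial>hausdorff_on k V)"
    by (subst P.Fubini'[OF m2, symmetric]) (simp add: mult.commute)
  also have "\<dots> = (\<integral>\<^sup>+y. h y * (\<integral>\<^sup>+l. q (y - l) \<partial>hausdorff_on j L) \<partial>hausdorff_on k V)"
    by (subst nn_integral_cmult) simp_all
  finally show ?thesis .
qed

definition hausdorff_integral_over :: "'a::euclidean_space set \<Rightarrow> ('a \<Rightarrow> real) \<Rightarrow> ennreal" where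
  "hausdorff_integral_over S f = (\<integral>\<^sup>+y\<in>S. ennreal (f y) \<partial>hausdorff_measure (adim S))"

text \<open>On the affine hull, unlike on \<open>S\<close> itself, the measure is invariant under
  translations along the direction of \<open>S\<close>.\<close>

lemma hausdorff_integral_over_eq:
  fixes S :: "'a::euclidean_space set"
  assumes "(\<lambda>y. ennreal (f y) * indicator S y) \<in> borel_measurable borel"
  shows "hausdorff_integral_over S f
    = (\<integral>\<^sup>+y. ennreal (f y) * indicator S y \<partial>hausdorff_on (adim S) (affine hull S))"
proof -
  have "(ennreal (f y) * indicator S y) * indicator (affine hull S) y = ennreal (f y) * indicator S y" for y
    using hull_subset[of S affine] by (auto split: split_indicator)
  then show ?thesis
    unfolding hausdorff_integral_over_def
    by (subst nn_integral_hausdorff_on) (auto simp: assms borel_closed)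
qed

text \<open>Any point \<open>w\<close> of \<open>S\<close> parametrizes the affine hull by its
  direction, in both orientations because a subspace is symmetric. The plus sign serves the slices
  of the cost, the minus sign the reflected slices of the density.\<close>

lemma hausdorff_integral_over_shift:
  fixes S :: "'a::euclidean_space set" and h :: "'a \<Rightarrow> ennreal"
  assumes w: "w \<in> S" and [measurable]: "h \<in> borel_measurable borel"
  shows "(\<integral>\<^sup>+l. h (w + l) \<partial>hausdorff_on (adim S) (direction S))
      = (\<integral>\<^sup>+y. h y \<partial>hausdorff_on (adim S) (affine hull S))"
    and "(\<integral>\<^sup>+l. h (w - l) \<partial>hausdorff_on (adim S) (direction S))
      = (\<integral>\<^sup>+y. h y \<partial>hausdorff_on (adim S) (affine hull S))"
proof -
  have [measurable]: "direction S \<in> sets borel" "affine hull S \<in> sets borel"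
    by (auto simp: borel_closed closed_subspace)
  have 1: "(\<lambda>l. w + l) ` direction S = affine hull S" by (simp add: affine_hull_eq_direction[OF w])
  have 2: "(\<lambda>l. w - l) ` direction S = affine hull S"
  proof -
    have "(\<lambda>l. w - l) ` direction S = (\<lambda>l. w + l) ` uminus ` direction S" by (simp add: image_image)
    also have "uminus ` direction S = direction S"
      by (auto intro!: image_eqI[of _ _ "- _"] subspace_neg)
    finally show ?thesis using 1 by simp
  qed
  show "(\<integral>\<^sup>+l. h (w + l) \<partial>hausdorff_on (adim S) (direction S))
      = (\<integral>\<^sup>+y. h y \<partial>hausdorff_on (adim S) (affine hull S))"
    using nn_integral_hausdorff_on_isometry[of "\<lambda>l. w + l" "direction S" h] 1 by simp
  have "dist (w - x) (w - y) = dist x y" for x y by (simp add: dist_norm norm_minus_commute)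
  then show "(\<integral>\<^sup>+l. h (w - l) \<partial>hausdorff_on (adim S) (direction S))
      = (\<integral>\<^sup>+y. h y \<partial>hausdorff_on (adim S) (affine hull S))"
    using nn_integral_hausdorff_on_isometry[of "\<lambda>l. w - l" "direction S" h] 2 by simp
qed

text \<open>The condition \<open>rel_interior_stable\<close> is what makes the normalized Hausdorff measures on the
  values vary continuously even where the dimension of \<open>S x\<close> jumps: near a limit point, translates
  of relatively interior points remain in the nearby values.\<close>

locale stable_convex_map =
  fixes D :: "'a::metric_space set" and Y :: "'b::euclidean_space set" and S :: "'a \<Rightarrow> 'b set"
  assumes compact_Y: "compact Y"
    and nonempty: "\<And>x. x \<in> D \<Longrightarrow> S x \<noteq> {}"
    and convex: "\<And>x. x \<in> D \<Longrightarrow> convex (S x)"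
    and compact: "\<And>x. x \<in> D \<Longrightarrow> compact (S x)"
    and subset_Y: "\<And>x. x \<in> D \<Longrightarrow> S x \<subseteq> Y"
    and closed_graph: "\<And>x x0 y y0. (\<And>n. x n \<in> D) \<Longrightarrow> x0 \<in> D \<Longrightarrow> x \<longlonglongrightarrow> x0 \<Longrightarrow>
      (\<And>n. y n \<in> S (x n)) \<Longrightarrow> y \<longlonglongrightarrow> y0 \<Longrightarrow> y0 \<in> S x0"
    and rel_interior_stable: "\<And>x x0 y y0 z. (\<And>n. x n \<in> D) \<Longrightarrow> x0 \<in> D \<Longrightarrow> x \<longlonglongrightarrow> x0 \<Longrightarrow>
      (\<And>n. y n \<in> S (x n)) \<Longrightarrow> y \<longlonglongrightarrow> y0 \<Longrightarrow> z \<in> rel_interior (S x0) \<Longrightarrow>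
      \<forall>\<^sub>F n in sequentially. z + (y n - y0) \<in> S (x n)"
begin

section \<open>Uniform estimates along convergent parameters\<close>

lemma borel_values: "x \<in> D \<Longrightarrow> S x \<in> sets borel"
  by (simp add: borel_compact compact)

text \<open>If the property failed infinitely often, the witnesses would have a convergent
  subsequence in the compact \<open>Y\<close>, with limit in \<open>S x0\<close> by the closed
  graph. Uniform claims thus reduce to finding one good index along each convergent
  sequence.\<close>

lemma uniform_on_values:
  assumes x: "\<And>n. x n \<in> D" "x0 \<in> D" "x \<longlonglongrightarrow> x0"
    and Q: "\<And>\<phi> y y0. strict_mono \<phi> \<Longrightarrow> (\<And>j. y j \<in> S (x (\<phi> j))) \<Longrightarrow> y \<longlonglongrightarrow> y0 \<Longrightarrow> y0 \<in> S x0 \<Longrightarrow>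
      \<exists>j::nat. Q (\<phi> j) (y j)"
  shows "\<forall>\<^sub>F n in sequentially. \<forall>y\<in>S (x n). Q n y"
proof (rule ccontr)
  assume "\<not> ?thesis"
  then obtain r :: "nat \<Rightarrow> nat" where r: "strict_mono r" "\<And>n. \<not> (\<forall>y\<in>S (x (r n)). Q (r n) y)"
    using not_eventually_sequentiallyD by blast
  then obtain y where y: "\<And>n. y n \<in> S (x (r n))" "\<And>n. \<not> Q (r n) (y n)" by metis
  have "\<forall>n. y n \<in> Y" using y(1) subset_Y x(1) by blast
  then obtain y0 s where s: "strict_mono s" "(y \<circ> s) \<longlonglongrightarrow> y0"
    using compact_Y unfolding compact_def by metis
  have "(x \<circ> (r \<circ> s)) \<longlonglongrightarrow> x0"
    by (rule LIMSEQ_subseq_LIMSEQ[OF x(3) strict_mono_o[OF r(1) s(1)]])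
  then have "y0 \<in> S x0"
    using x y s by (intro closed_graph[of "x \<circ> (r \<circ> s)" x0 "y \<circ> s"]) auto
  then show False
    using Q[of "r \<circ> s" "y \<circ> s" y0] r(1) s y by (auto simp: strict_mono_o)
qed

text \<open>Around \<open>z\<close> in the relative interior of \<open>S x0\<close>, the points
  \<open>z\<close> and \<open>z + e *\<^sub>R b\<close> for a finite basis of unit vectors
  \<open>b\<close> all move along into \<open>S (x n)\<close>. Their differences recover the basis
  inside the direction of \<open>S (x n)\<close>.\<close>

lemma direction_subset_eventually:
  assumes x: "\<And>n. x n \<in> D" "x0 \<in> D" "x \<longlonglongrightarrow> x0"
  shows "\<forall>\<^sub>F n in sequentially. direction (S x0) \<subseteq> direction (S (x n))"
proof -
  have "\<forall>\<^sub>F n in sequentially. \<forall>y\<in>S (x n). direction (S x0) \<subseteq> direction (S (x n))"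
  proof (rule uniform_on_values[OF x])
    fix \<phi> :: "nat \<Rightarrow> nat" and y y0
    assume \<phi>: "strict_mono \<phi>" and y: "\<And>j. y j \<in> S (x (\<phi> j))" "y \<longlonglongrightarrow> y0" "y0 \<in> S x0"
    have x\<phi>: "(\<lambda>j. x (\<phi> j)) \<longlonglongrightarrow> x0"
      using LIMSEQ_subseq_LIMSEQ[OF x(3) \<phi>] by (simp add: o_def)
    have stable: "\<forall>\<^sub>F j in sequentially. z + (y j - y0) \<in> S (x (\<phi> j))" if "z \<in> rel_interior (S x0)" for z
      by (rule rel_interior_stable[OF _ x(2) x\<phi> y(1,2) that]) (rule x(1))
    obtain z where z: "z \<in> rel_interior (S x0)"
      using x(2) nonempty convex rel_interior_eq_empty by blast
    then obtain e where e: "0 < e" "cball z e \<inter> affine hull (S x0) \<subseteq> rel_interior (S x0)"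
      using openin_rel_interior[of "S x0"] by (auto simp: openin_contains_cball)
    have zS: "z \<in> S x0" using z rel_interior_subset by blast
    obtain B where B: "B \<subseteq> direction (S x0)" "\<And>b. b \<in> B \<Longrightarrow> norm b = 1"
      "independent B" "span B = direction (S x0)"
      using orthonormal_basis_subspace[OF subspace_direction[of "S x0"]] by metis
    have "finite B" using B(3) by (rule independent_imp_finite)
    have in_ri: "z + e *\<^sub>R b \<in> rel_interior (S x0)" if "b \<in> B" for b
    proof -
      have "z + e *\<^sub>R b \<in> affine hull (S x0)"
        using that B(1) by (auto simp: mem_affine_hull_iff[OF zS] intro!: subspace_scale)
      moreover have "z + e *\<^sub>R b \<in> cball z e" using e B(2)[OF that] by (simp add: dist_norm)
      ultimately show ?thesis using e by blast
    qed
    have "\<forall>\<^sub>F j in sequentially. \<forall>b\<in>B. z + e *\<^sub>R b + (y j - y0) \<in> S (x (\<phi> j))"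
      using \<open>finite B\<close> stable in_ri by (intro eventually_ball_finite) auto
    then have "\<forall>\<^sub>F j in sequentially. direction (S x0) \<subseteq> direction (S (x (\<phi> j)))"
      using stable[OF z]
    proof eventually_elim
      case (elim j)
      have "b \<in> direction (S (x (\<phi> j)))" if "b \<in> B" for b
      proof -
        have "(z + e *\<^sub>R b + (y j - y0)) - (z + (y j - y0)) \<in> direction (S (x (\<phi> j)))"
          using elim that by (intro diff_mem_direction) auto
        then have "e *\<^sub>R b \<in> direction (S (x (\<phi> j)))" by simp
        then have "(1 / e) *\<^sub>R (e *\<^sub>R b) \<in> direction (S (x (\<phi> j)))"
          by (rule subspace_scale[OF subspace_direction])
        then show ?thesis using e(1) by simp
      qed
      then show ?case using B(4) span_minimal[of B "direction (S (x (\<phi> j)))"] by auto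
    qed
    then show "\<exists>j. direction (S x0) \<subseteq> direction (S (x (\<phi> j)))"
      by (rule eventually_happens'[OF sequentially_bot])
  qed
  then show ?thesis by eventually_elim (use nonempty x in blast)
qed

text \<open>Fatou's lemma along base points \<open>y j\<close> that converge to \<open>y0\<close>.
  The slice through \<open>y0\<close> is all of \<open>S x0\<close>, so the limit integral does not
  depend on \<open>y0\<close>.\<close>

lemma lower_bound_of_slices:
  fixes g :: "'a \<times> 'b \<Rightarrow> real"
  assumes x: "\<And>n. x n \<in> D" "x0 \<in> D" "x \<longlonglongrightarrow> x0"
    and g: "lower_semicontinuous_on (D \<times> Y) g"
    and t: "t < hausdorff_integral_over (S x0) (\<lambda>y. g (x0, y))"
  defines "h \<equiv> \<lambda>n y. ennreal (g (x n, y)) * indicator (S (x n)) y"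
  shows "\<forall>\<^sub>F n in sequentially. \<forall>y\<in>S (x n).
    t \<le> (\<integral>\<^sup>+l. h n (y + l) \<partial>hausdorff_on (adim (S x0)) (direction (S x0)))"
proof (rule uniform_on_values[OF x], rule ccontr)
  let ?\<mu> = "hausdorff_on (adim (S x0)) (direction (S x0))"
  define h0 where "h0 y = ennreal (g (x0, y)) * indicator (S x0) y" for y
  have Yb: "Y \<in> sets borel" using compact_Y by (simp add: borel_compact)
  have meas: "(\<lambda>y. ennreal (g (u, y)) * indicator (S u) y) \<in> borel_measurable borel" if "u \<in> D" for u
    using that
    by (intro lower_semicontinuous_on_measurable[of Y] lower_semicontinuous_on_section[OF g]
        borel_values subset_Y Yb)
  have [measurable]: "h n \<in> borel_measurable borel" "h0 \<in> borel_measurable borel" for n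
    using meas x by (simp_all add: h_def h0_def[abs_def])
  fix \<phi> :: "nat \<Rightarrow> nat" and y y0
  assume \<phi>: "strict_mono \<phi>" and y: "\<And>j. y j \<in> S (x (\<phi> j))" "y \<longlonglongrightarrow> y0" "y0 \<in> S x0"
  assume neg: "\<nexists>j. t \<le> (\<integral>\<^sup>+l. h (\<phi> j) (y j + l) \<partial>?\<mu>)"
  have x\<phi>: "(\<lambda>j. x (\<phi> j)) \<longlonglongrightarrow> x0"
    using LIMSEQ_subseq_LIMSEQ[OF x(3) \<phi>] by (simp add: o_def)
  \<comment> \<open>Relative interior points are followed by points of the nearby values, where
    semicontinuity applies; outside \<open>S x0\<close> the left side is 0. Only the relative
    frontier is left out.\<close>
  have lim: "h0 (y0 + l) \<le> liminf (\<lambda>j. h (\<phi> j) (y j + l))"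
    if l: "y0 + l \<notin> S x0 - rel_interior (S x0)" for l
  proof (cases "y0 + l \<in> S x0")
    case True
    then have ri: "y0 + l \<in> rel_interior (S x0)" using l by blast
    have "\<forall>\<^sub>F j in sequentially. (y0 + l) + (y j - y0) \<in> S (x (\<phi> j))"
      by (rule rel_interior_stable[OF _ x(2) x\<phi> y(1,2) ri]) (rule x(1))
    then have S: "\<forall>\<^sub>F j in sequentially. y j + l \<in> S (x (\<phi> j))"
      by eventually_elim (simp add: algebra_simps)
    have "\<forall>\<^sub>F j in sequentially. c < h (\<phi> j) (y j + l)" if c: "c < h0 (y0 + l)" for c
    proof -
      have cg: "c < ennreal (g (x0, y0 + l))" using c True by (simp add: h0_def)
      then obtain s where s: "c = ennreal s" "0 \<le> s" by (cases c) auto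
      have sg: "s < g (x0, y0 + l)" using cg s by (simp add: ennreal_less_iff)
      have "\<forall>\<^sub>F j in sequentially. (x (\<phi> j), y j + l) \<in> D \<times> Y \<longrightarrow> s < g (x (\<phi> j), y j + l)"
        using x True subset_Y sg
        by (intro lower_semicontinuous_on_eventually[OF g, of "(x0, y0 + l)"] tendsto_intros x\<phi> y) auto
      then show ?thesis using S
      proof eventually_elim
        case (elim j)
        then show ?case using x(1) subset_Y[OF x(1)] s by (auto simp: h_def ennreal_less_iff)
      qed
    qed
    then show ?thesis by (simp add: le_Liminf_iff)
  qed (simp add: h0_def)
  \<comment> \<open>Translation by \<open>y0\<close> carries the exceptional part of the direction
    into the relative frontier, a null set.\<close>
  have AE: "AE l in ?\<mu>. y0 + l \<notin> S x0 - rel_interior (S x0)"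
  proof (rule AE_I)
    let ?N = "{l. y0 + l \<in> S x0 - rel_interior (S x0)}"
    have b: "S x0 - rel_interior (S x0) \<in> sets borel" using borel_values[OF x(2)] by auto
    have "(\<lambda>l. y0 + l) -` (S x0 - rel_interior (S x0)) \<inter> space borel \<in> sets borel"
      by (rule measurable_sets[OF _ b]) measurable
    then show N: "?N \<in> sets ?\<mu>" by (simp add: vimage_def)
    have "emeasure ?\<mu> ?N = hausdorff_outer_measure (adim (S x0)) (?N \<inter> direction (S x0))"
      using N by (intro emeasure_hausdorff_on) (simp_all add: borel_closed closed_subspace)
    also have "\<dots> = hausdorff_outer_measure (adim (S x0)) ((\<lambda>l. y0 + l) ` (?N \<inter> direction (S x0)))"
      by (rule hausdorff_outer_isometry[symmetric]) simp
    also have "\<dots> \<le> hausdorff_outer_measure (adim (S x0)) (S x0 - rel_interior (S x0))"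
      by (rule hausdorff_outer_mono) auto
    also have "\<dots> = 0" by (intro hausdorff_rel_frontier_null nonempty convex compact x)
    finally show "emeasure ?\<mu> ?N = 0" by simp
  qed auto
  have "hausdorff_integral_over (S x0) (\<lambda>y. g (x0, y)) = (\<integral>\<^sup>+l. h0 (y0 + l) \<partial>?\<mu>)"
    using hausdorff_integral_over_shift(1)[OF y(3), of h0] meas[OF x(2)]
    by (subst hausdorff_integral_over_eq) (simp_all add: h0_def[abs_def])
  also have "\<dots> \<le> (\<integral>\<^sup>+l. liminf (\<lambda>j. h (\<phi> j) (y j + l)) \<partial>?\<mu>)"
    using AE by (intro nn_integral_mono_AE) (auto intro: lim)
  also have "\<dots> \<le> liminf (\<lambda>j. \<integral>\<^sup>+l. h (\<phi> j) (y j + l) \<partial>?\<mu>)"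
    by (rule nn_integral_liminf) simp
  also have "\<dots> \<le> t"
    using neg by (intro Liminf_le) (auto simp: not_le intro!: always_eventually less_imp_le)
  finally show False using t by simp
qed

text \<open>The counterpart by reverse Fatou. No null set has to be removed: the closed graph expels
  points outside \<open>S x0\<close> from the nearby values, and at the points of
  \<open>S x0\<close> continuity bounds the density from above.\<close>

lemma upper_bound_of_slices:
  fixes \<rho> :: "'a \<times> 'b \<Rightarrow> real"
  assumes D: "compact D" and x: "\<And>n. x n \<in> D" "x0 \<in> D" "x \<longlonglongrightarrow> x0"
    and \<rho>: "continuous_on (D \<times> Y) \<rho>"
    and r: "hausdorff_integral_over (S x0) (\<lambda>y. \<rho> (x0, y)) < r"
  defines "q \<equiv> \<lambda>n y. ennreal (\<rho> (x n, y)) * indicator (S (x n)) y"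
  shows "\<forall>\<^sub>F n in sequentially. \<forall>y\<in>S (x n).
    (\<integral>\<^sup>+l. q n (y - l) \<partial>hausdorff_on (adim (S x0)) (direction (S x0))) \<le> r"
proof (rule uniform_on_values[OF x], rule ccontr)
  let ?\<mu> = "hausdorff_on (adim (S x0)) (direction (S x0))"
  define q0 where "q0 y = ennreal (\<rho> (x0, y)) * indicator (S x0) y" for y
  have Yb: "Y \<in> sets borel" using compact_Y by (simp add: borel_compact)
  have meas: "(\<lambda>y. ennreal (\<rho> (u, y)) * indicator (S u) y) \<in> borel_measurable borel" if "u \<in> D" for u
    using that
    by (intro lower_semicontinuous_on_measurable[of Y] borel_values subset_Y Yb
        lower_semicontinuous_on_section[OF continuous_on_imp_lower_semicontinuous_on[OF \<rho>]])
  have [measurable]: "q n \<in> borel_measurable borel" "q0 \<in> borel_measurable borel" for n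
    using meas x by (simp_all add: q_def q0_def[abs_def])
  obtain C where C: "\<And>p. p \<in> D \<times> Y \<Longrightarrow> \<rho> p \<le> C"
  proof -
    have "bounded (\<rho> ` (D \<times> Y))"
      by (intro compact_imp_bounded compact_continuous_image \<rho> compact_Times D compact_Y)
    then obtain C where "\<forall>v \<in> \<rho> ` (D \<times> Y). norm v \<le> C" by (auto simp: bounded_iff)
    then show thesis using that[of C] by (fastforce simp: abs_le_iff)
  qed
  obtain M where M: "\<And>v. v \<in> Y \<Longrightarrow> norm v \<le> M"
    using compact_imp_bounded[OF compact_Y] by (auto simp: bounded_iff)
  fix \<phi> :: "nat \<Rightarrow> nat" and y y0
  assume \<phi>: "strict_mono \<phi>" and y: "\<And>j. y j \<in> S (x (\<phi> j))" "y \<longlonglongrightarrow> y0" "y0 \<in> S x0"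
  assume neg: "\<nexists>j. (\<integral>\<^sup>+l. q (\<phi> j) (y j - l) \<partial>?\<mu>) \<le> r"
  have x\<phi>: "(\<lambda>j. x (\<phi> j)) \<longlonglongrightarrow> x0"
    using LIMSEQ_subseq_LIMSEQ[OF x(3) \<phi>] by (simp add: o_def)
  have lim: "limsup (\<lambda>j. q (\<phi> j) (y j - l)) \<le> q0 (y0 - l)" for l
  proof -
    have "\<forall>\<^sub>F j in sequentially. q (\<phi> j) (y j - l) < c" if c: "q0 (y0 - l) < c" for c
    proof (cases "y0 - l \<in> S x0")
      case True
      have "\<forall>\<^sub>F j in sequentially. (x (\<phi> j), y j - l) \<in> D \<times> Y \<longrightarrow> ennreal (\<rho> (x (\<phi> j), y j - l)) < c"
      proof -
        have "continuous_on (D \<times> Y) (\<lambda>p. ennreal (\<rho> p))" by (intro continuous_on_ennreal \<rho>)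
        then have "((\<lambda>p. ennreal (\<rho> p)) \<longlongrightarrow> ennreal (\<rho> (x0, y0 - l))) (at (x0, y0 - l) within D \<times> Y)"
          unfolding continuous_on_def using x(2) True subset_Y[OF x(2)] by (elim bspec) auto
        then have "\<forall>\<^sub>F p in at (x0, y0 - l) within D \<times> Y. ennreal (\<rho> p) < c"
          using c True by (intro order_tendstoD(2)) (auto simp: q0_def)
        then have "\<forall>\<^sub>F p in nhds (x0, y0 - l). p \<in> D \<times> Y \<longrightarrow> ennreal (\<rho> p) < c"
          unfolding eventually_at_filter by (rule eventually_mono) (use c True in \<open>auto simp: q0_def\<close>)
        then show ?thesis
          by (rule eventually_compose_filterlim) (intro tendsto_intros x\<phi> y)
      qed
      then show ?thesis
      proof eventually_elim
        case (elim j)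
        then show ?case using x(1) subset_Y[OF x(1)] c
          by (cases "y j - l \<in> S (x (\<phi> j))") (auto simp: q_def intro: le_less_trans[OF zero_le])
      qed
    next
      case False
      have "\<forall>\<^sub>F j in sequentially. y j - l \<notin> S (x (\<phi> j))"
      proof (rule ccontr)
        assume "\<not> ?thesis"
        then obtain s :: "nat \<Rightarrow> nat" where s: "strict_mono s" "\<And>n. \<not> (y (s n) - l \<notin> S (x (\<phi> (s n))))"
          using not_eventually_sequentiallyD by blast
        have "(\<lambda>n. x (\<phi> (s n))) \<longlonglongrightarrow> x0" "(\<lambda>n. y (s n) - l) \<longlonglongrightarrow> y0 - l"
          using LIMSEQ_subseq_LIMSEQ[OF x\<phi> s(1)] LIMSEQ_subseq_LIMSEQ[OF y(2) s(1)]
          by (auto simp: o_def intro!: tendsto_intros)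
        then have "y0 - l \<in> S x0"
          using s(2) x by (intro closed_graph[of "\<lambda>n. x (\<phi> (s n))" x0 "\<lambda>n. y (s n) - l"]) auto
        then show False using False by simp
      qed
      then show ?thesis
        by eventually_elim (use c in \<open>auto simp: q_def intro: le_less_trans[OF zero_le]\<close>)
    qed
    then show ?thesis by (simp add: Limsup_le_iff)
  qed
  have "r \<le> limsup (\<lambda>j. \<integral>\<^sup>+l. q (\<phi> j) (y j - l) \<partial>?\<mu>)"
    using neg by (intro le_Limsup) (auto simp: not_le intro!: always_eventually less_imp_le)
  also have "\<dots> \<le> (\<integral>\<^sup>+l. limsup (\<lambda>j. q (\<phi> j) (y j - l)) \<partial>?\<mu>)"
  proof (rule nn_integral_limsup)
    \<comment> \<open>The dominating function: \<open>C\<close> bounds the density, and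
      \<open>l\<close> is a difference of two points of \<open>Y\<close>, so its norm is at most
      \<open>2 * M\<close>. A ball of the direction has finite measure in its own dimension.\<close>
    let ?w = "\<lambda>l. ennreal C * indicator (cball 0 (2 * M)) l"
    show "?w \<in> borel_measurable ?\<mu>" unfolding measurable_hausdorff_on
      by (intro borel_measurable_times_ennreal borel_measurable_const borel_measurable_indicator
          borel_closed closed_cball)
    have "q (\<phi> j) (y j - l) \<le> ?w l" for j l
    proof (cases "y j - l \<in> S (x (\<phi> j))")
      case True
      then have Y: "y j - l \<in> Y" "y j \<in> Y" using y(1) subset_Y x(1) by blast+
      have "norm l \<le> norm (y j) + norm (y j - l)"
        using norm_triangle_ineq4[of "y j" "y j - l"] by simp
      then have "l \<in> cball 0 (2 * M)" using M[OF Y(1)] M[OF Y(2)] by simp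
      then show ?thesis using True C[of "(x (\<phi> j), y j - l)"] Y x(1)
        by (simp add: q_def ennreal_leI)
    qed (simp add: q_def)
    then show "AE l in ?\<mu>. q (\<phi> j) (y j - l) \<le> ?w l" for j by simp
    have "bounded (cball 0 (2 * M) \<inter> direction (S x0))" by (simp add: bounded_Int)
    moreover have "direction (S x0) \<noteq> {}" using subspace_0[OF subspace_direction] by blast
    ultimately have "hausdorff_outer_measure (adim (S x0)) (cball 0 (2 * M) \<inter> direction (S x0)) < \<top>"
      using hausdorff_outer_bounded_finite[of "direction (S x0)" "cball 0 (2 * M) \<inter> direction (S x0)"]
      by (simp add: adim_direction nonempty x affine_hull_subspace)
    then show "(\<integral>\<^sup>+l. ?w l \<partial>?\<mu>) < \<infinity>"
      by (subst nn_integral_cmult_indicator)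
         (simp_all add: emeasure_hausdorff_on borel_closed closed_subspace ennreal_mult_less_top)
  qed simp
  also have "\<dots> \<le> (\<integral>\<^sup>+l. q0 (y0 - l) \<partial>?\<mu>)"
    by (intro nn_integral_mono lim)
  also have "\<dots> = hausdorff_integral_over (S x0) (\<lambda>y. \<rho> (x0, y))"
    using hausdorff_integral_over_shift(2)[OF y(3), of q0] meas[OF x(2)]
    by (subst hausdorff_integral_over_eq) (simp_all add: q0_def[abs_def])
  finally show False using r by simp
qed

text \<open>For \<open>t\<close> below \<open>J x0\<close> and \<open>r\<close> above
  \<open>R x0\<close>, the slice estimates bound the two sides of the translation identity and give
  \<open>R (x n) * t \<le> J (x n) * r\<close> eventually. First \<open>n\<close> tends to infinity,
  then \<open>t\<close> increases to \<open>J x0\<close> and \<open>r\<close> decreases to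
  \<open>R x0\<close>.\<close>

lemma ratio_le_limit:
  fixes g \<rho> :: "'a \<times> 'b \<Rightarrow> real"
  defines "J \<equiv> \<lambda>x. hausdorff_integral_over (S x) (\<lambda>y. g (x, y))"
    and "R \<equiv> \<lambda>x. hausdorff_integral_over (S x) (\<lambda>y. \<rho> (x, y))"
  assumes D: "compact D" and x: "\<And>n. x n \<in> D" "x0 \<in> D" "x \<longlonglongrightarrow> x0"
    and g: "lower_semicontinuous_on (D \<times> Y) g"
    and \<rho>: "continuous_on (D \<times> Y) \<rho>"
    and R: "\<And>x. x \<in> D \<Longrightarrow> 0 < R x" "\<And>x. x \<in> D \<Longrightarrow> R x < \<top>"
    and lim: "(\<lambda>n. J (x n) / R (x n)) \<longlonglongrightarrow> m"
  shows "J x0 / R x0 \<le> m"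
proof -
  have Yb: "Y \<in> sets borel" using compact_Y by (simp add: borel_compact)
  have key: "\<forall>\<^sub>F n in sequentially. t \<le> r * (J (x n) / R (x n))" if t: "t < J x0" and r: "R x0 < r" for t r
    using lower_bound_of_slices[OF x g t[unfolded J_def]]
      upper_bound_of_slices[OF D x \<rho> r[unfolded R_def]] direction_subset_eventually[OF x]
  proof eventually_elim
    case (elim n)
    let ?\<mu> = "hausdorff_on (adim (S x0)) (direction (S x0))"
    let ?\<nu> = "hausdorff_on (adim (S (x n))) (affine hull (S (x n)))"
    let ?q = "\<lambda>y. ennreal (\<rho> (x n, y)) * indicator (S (x n)) y"
    let ?h = "\<lambda>y. ennreal (g (x n, y)) * indicator (S (x n)) y"
    have q: "?q \<in> borel_measurable borel"
      by (intro lower_semicontinuous_on_measurable[of Y] borel_values subset_Y Yb x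
        lower_semicontinuous_on_section[OF continuous_on_imp_lower_semicontinuous_on[OF \<rho>]])
    have h: "?h \<in> borel_measurable borel"
      by (intro lower_semicontinuous_on_measurable[of Y] lower_semicontinuous_on_section[OF g]
        borel_values subset_Y Yb x)
    obtain a where a: "a \<in> S (x n)" using nonempty x by blast
    have "direction (S x0) \<noteq> {}" using subspace_0[OF subspace_direction] by blast
    then have "sigma_finite_measure ?\<mu>"
      using sigma_finite_hausdorff_on_affine_hull[of "direction (S x0)"]
      by (simp add: adim_direction nonempty x affine_hull_subspace)
    moreover have "sigma_finite_measure ?\<nu>"
      by (intro sigma_finite_hausdorff_on_affine_hull nonempty x)
    \<comment> \<open>The inclusion of directions enters here: it makes the affine hull of
      \<open>S (x n)\<close> invariant under the direction of \<open>S x0\<close>, although the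
      dimensions may differ.\<close>
    moreover have "(\<lambda>y. y + l) ` (affine hull S (x n)) = affine hull S (x n)"
      if "l \<in> direction (S x0)" for l
    proof -
      have l: "l \<in> direction (S (x n))" using that elim by blast
      have sum: "y + l \<in> affine hull S (x n)" if "y \<in> affine hull S (x n)" for y
      proof -
        have "(y - a) + l \<in> direction (S (x n))"
          using that l unfolding mem_affine_hull_iff[OF a] by (rule subspace_add[OF subspace_direction])
        then show ?thesis by (simp add: mem_affine_hull_iff[OF a] algebra_simps)
      qed
      have diff: "y - l \<in> affine hull S (x n)" if "y \<in> affine hull S (x n)" for y
      proof -
        have "(y - a) - l \<in> direction (S (x n))"
          using that l unfolding mem_affine_hull_iff[OF a] by (rule subspace_diff[OF subspace_direction])
        then show ?thesis by (simp add: mem_affine_hull_iff[OF a] algebra_simps)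
      qed
      show ?thesis
      proof (intro equalityI subsetI)
        fix y assume "y \<in> affine hull S (x n)"
        then have "(y - l) + l \<in> (\<lambda>y. y + l) ` (affine hull S (x n))" by (intro imageI diff)
        then show "y \<in> (\<lambda>y. y + l) ` (affine hull S (x n))" by simp
      qed (use sum in blast)
    qed
    ultimately have swap: "(\<integral>\<^sup>+y. ?q y * (\<integral>\<^sup>+l. ?h (y + l) \<partial>?\<mu>) \<partial>?\<nu>)
        = (\<integral>\<^sup>+y. ?h y * (\<integral>\<^sup>+l. ?q (y - l) \<partial>?\<mu>) \<partial>?\<nu>)"
      using q h
      by (intro nn_integral_translation_swap) (simp_all add: borel_closed closed_subspace)
    have "R (x n) * t = (\<integral>\<^sup>+y. ?q y * t \<partial>?\<nu>)"
      unfolding R_def hausdorff_integral_over_eq[OF q] using q by (subst nn_integral_multc) simp_all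
    also have "\<dots> \<le> (\<integral>\<^sup>+y. ?q y * (\<integral>\<^sup>+l. ?h (y + l) \<partial>?\<mu>) \<partial>?\<nu>)"
      using elim by (intro nn_integral_mono) (auto split: split_indicator intro: mult_left_mono)
    also note swap
    also have "(\<integral>\<^sup>+y. ?h y * (\<integral>\<^sup>+l. ?q (y - l) \<partial>?\<mu>) \<partial>?\<nu>) \<le> (\<integral>\<^sup>+y. ?h y * r \<partial>?\<nu>)"
      using elim by (intro nn_integral_mono) (auto split: split_indicator intro: mult_left_mono)
    also have "\<dots> = J (x n) * r"
      unfolding J_def hausdorff_integral_over_eq[OF h] using h by (subst nn_integral_multc) simp_all
    finally have "R (x n) * t / R (x n) \<le> J (x n) * r / R (x n)" by (rule divide_right_mono_ennreal)
    moreover have "R (x n) * t / R (x n) = t"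
      using mult_divide_eq_ennreal[of "R (x n)" t] R[OF x(1), of n] by (simp add: mult.commute)
    ultimately show ?case by (simp add: ennreal_times_divide mult.commute)
  qed
  have le: "J x0 \<le> r * m" if r: "R x0 < r" "r < \<top>" for r
  proof (rule dense_le)
    fix t assume "t < J x0"
    then have "\<forall>\<^sub>F n in sequentially. t \<le> r * (J (x n) / R (x n))" using key r by blast
    moreover have "(\<lambda>n. r * (J (x n) / R (x n))) \<longlonglongrightarrow> r * m"
      using lim r by (intro ennreal_tendsto_cmult)
    ultimately show "t \<le> r * m" by (intro tendsto_lowerbound[of _ "r * m"]) auto
  qed
  \<comment> \<open>Letting \<open>r\<close> decrease to \<open>R x0\<close> amounts to a division
    by \<open>m\<close>. If \<open>m\<close> is 0 then a single \<open>r1\<close> forces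
    \<open>J x0 = 0\<close>; if \<open>m\<close> is infinite, the right-hand side is infinite since
    \<open>R x0\<close> is positive.\<close>
  obtain r1 where r1: "R x0 < r1" "r1 < \<top>" using dense[OF R(2)[OF x(2)]] by blast
  have "J x0 \<le> R x0 * m"
  proof (cases "m = 0 \<or> m = \<top>")
    case True
    then show ?thesis using le[OF r1] R[OF x(2)] by (auto simp: ennreal_mult_top)
  next
    case False
    have "J x0 / m \<le> R x0"
    proof (rule dense_ge)
      fix r assume "R x0 < r"
      then have "J x0 \<le> m * r" using le[of r] False
        by (cases "r = \<top>") (auto simp: mult.commute less_top ennreal_mult_top)
      then show "J x0 / m \<le> r" using False by (intro divide_le_posI_ennreal) (auto simp: zero_less_iff_neq_zero)
    qed
    then have "J x0 / m * m \<le> R x0 * m" by (rule mult_right_mono) simp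
    moreover have "J x0 / m * m = J x0"
      using False mult_divide_eq_ennreal[of m "J x0"] by (simp add: ennreal_times_divide mult.commute)
    ultimately show ?thesis by simp
  qed
  then show ?thesis using R(1)[OF x(2)] by (intro divide_le_posI_ennreal) auto
qed

lemma ratio_attains_minimum:
  fixes g \<rho> :: "'a \<times> 'b \<Rightarrow> real"
  defines "J \<equiv> \<lambda>x. hausdorff_integral_over (S x) (\<lambda>y. g (x, y))"
    and "R \<equiv> \<lambda>x. hausdorff_integral_over (S x) (\<lambda>y. \<rho> (x, y))"
  assumes D: "compact D" "D \<noteq> {}"
    and g: "lower_semicontinuous_on (D \<times> Y) g"
    and \<rho>: "continuous_on (D \<times> Y) \<rho>"
    and R: "\<And>x. x \<in> D \<Longrightarrow> 0 < R x" "\<And>x. x \<in> D \<Longrightarrow> R x < \<top>"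
  shows "\<exists>x\<in>D. \<forall>x'\<in>D. J x / R x \<le> J x' / R x'"
proof -
  let ?F = "\<lambda>x. J x / R x"
  obtain u where u: "\<And>n. u n \<in> ?F ` D" "u \<longlonglongrightarrow> Inf (?F ` D)"
    using Inf_as_limit[of "?F ` D"] D(2) by auto
  then have "\<forall>n. \<exists>z\<in>D. u n = ?F z" by blast
  then obtain x where x: "\<And>n. x n \<in> D" "\<And>n. u n = ?F (x n)" by metis
  obtain x0 s where s: "x0 \<in> D" "strict_mono s" "(x \<circ> s) \<longlonglongrightarrow> x0"
    using D(1) x(1) unfolding compact_def by metis
  have "(\<lambda>n. ?F ((x \<circ> s) n)) \<longlonglongrightarrow> Inf (?F ` D)"
    using LIMSEQ_subseq_LIMSEQ[OF u(2) s(2)] by (simp add: o_def x(2))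
  then have "?F x0 \<le> Inf (?F ` D)"
    unfolding J_def R_def using x(1) s g \<rho> R[unfolded R_def]
    by (intro ratio_le_limit[of "x \<circ> s"] D) auto
  then show ?thesis using s(1) by (auto simp: le_Inf_iff)
qed

end

section \<open>Parametric linear programs\<close>

lemma convex_halfspaces: "convex {y. \<forall>i. a i \<bullet> y \<le> u i}"
proof -
  have "{y. \<forall>i. a i \<bullet> y \<le> u i} = (\<Inter>i. {y. a i \<bullet> y \<le> u i})" by auto
  then show ?thesis by (auto intro: convex_INT convex_halfspace_le)
qed

lemma closed_halfspaces: "closed {y. \<forall>i. a i \<bullet> y \<le> u i}"
proof -
  have "{y. \<forall>i. a i \<bullet> y \<le> u i} = (\<Inter>i. {y. a i \<bullet> y \<le> u i})" by auto
  then show ?thesis by (auto intro: closed_INT closed_halfspace_le)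
qed

text \<open>The segment from \<open>p\<close> to \<open>z\<close> can be prolonged beyond
  \<open>z\<close> inside \<open>P\<close>. A constraint that is strict at \<open>p\<close> and
  tight at \<open>z\<close> would be violated there.\<close>

lemma rel_interior_halfspaces_strict:
  fixes a :: "'i \<Rightarrow> 'b::euclidean_space"
  assumes P: "P = {y. \<forall>i. a i \<bullet> y \<le> u i}" and z: "z \<in> rel_interior P" and p: "p \<in> P" "a i \<bullet> p < u i"
  shows "a i \<bullet> z < u i"
proof -
  have "convex P" unfolding P by (rule convex_halfspaces)
  then obtain e where e: "1 < e" "(1 - e) *\<^sub>R p + e *\<^sub>R z \<in> P"
    using convex_rel_interior_if2[OF _ z] hull_inc[OF p(1)] by blast
  then have "(1 - e) * (a i \<bullet> p) + e * (a i \<bullet> z) \<le> u i" by (simp add: P inner_add_right)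
  moreover have "(e - 1) * (a i \<bullet> p) < (e - 1) * u i" using e(1) p(2) by simp
  ultimately have "e * (a i \<bullet> z) < e * u i" by (simp add: algebra_simps)
  then show ?thesis using e(1) by simp
qed

text \<open>A constraint is either an equation on the limit set, and then the translation by \<open>y n - y0\<close>
  inherits it from \<open>y n\<close>, or it is strict at \<open>z\<close>.\<close>

lemma halfspaces_rel_interior_stable:
  fixes a :: "'i::finite \<Rightarrow> 'b::euclidean_space"
  assumes u: "\<And>i. (\<lambda>n. u n i) \<longlonglongrightarrow> u0 i" and y: "\<And>n i. a i \<bullet> y n \<le> u n i" "y \<longlonglongrightarrow> y0"
    and z: "z \<in> rel_interior {y. \<forall>i. a i \<bullet> y \<le> u0 i}"
  shows "\<forall>\<^sub>F n in sequentially. \<forall>i. a i \<bullet> (z + (y n - y0)) \<le> u n i"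
proof -
  let ?P = "{y. \<forall>i. a i \<bullet> y \<le> u0 i}"
  have y0: "y0 \<in> ?P"
  proof (intro CollectI allI)
    fix i
    show "a i \<bullet> y0 \<le> u0 i"
      using u[of i] y(1) by (intro LIMSEQ_le[OF tendsto_inner[OF tendsto_const y(2)]]) auto
  qed
  have zP: "z \<in> ?P" using z rel_interior_subset by blast
  have "\<forall>\<^sub>F n in sequentially. a i \<bullet> (z + (y n - y0)) \<le> u n i" for i
  proof (cases "\<forall>p\<in>?P. a i \<bullet> p = u0 i")
    case True
    then have "a i \<bullet> z = u0 i" "a i \<bullet> y0 = u0 i" using zP y0 by auto
    then show ?thesis using y(1) by (simp add: inner_add_right inner_diff_right)
  next
    case False
    then obtain p where p: "p \<in> ?P" "a i \<bullet> p \<noteq> u0 i" by blast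
    then have "a i \<bullet> p < u0 i" by (simp add: order.strict_iff_order)
    with p(1) have "a i \<bullet> z < u0 i" by (rule rel_interior_halfspaces_strict[OF refl z])
    moreover have "(\<lambda>n. u n i - a i \<bullet> (z + (y n - y0))) \<longlonglongrightarrow> u0 i - a i \<bullet> (z + (y0 - y0))"
      by (intro tendsto_intros u y)
    ultimately have "\<forall>\<^sub>F n in sequentially. 0 < u n i - a i \<bullet> (z + (y n - y0))"
      by (intro order_tendstoD(1)) auto
    then show ?thesis by eventually_elim simp
  qed
  then show ?thesis by (simp add: eventually_all_finite)
qed

section \<open>Solution sets of linear programs with parametric right-hand sides\<close>

definition lp_feasible :: "real^'d^'m \<Rightarrow> real^'p^'m \<Rightarrow> real^'m \<Rightarrow> real^'d \<Rightarrow> (real^'p) set" where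
  "lp_feasible A B b x = {y. A *v x + B *v y \<le> b}"

definition lp_solutions ::
  "real^'d^'m \<Rightarrow> real^'p^'m \<Rightarrow> real^'m \<Rightarrow> real^'p \<Rightarrow> real^'d \<Rightarrow> (real^'p) set" where
  "lp_solutions A B b c x = {y. is_arg_min (\<lambda>z. c \<bullet> z) (\<lambda>z. z \<in> lp_feasible A B b x) y}"

lemma lp_feasible_eq: "lp_feasible A B b x = {y. \<forall>i. B $ i \<bullet> y \<le> b $ i - (A *v x) $ i}"
  by (auto simp: lp_feasible_def less_eq_vec_def matrix_vector_mul_component algebra_simps)

lemma lp_solutions_eq:
  assumes "y \<in> lp_solutions A B b c x"
  shows "lp_solutions A B b c x = {z. z \<in> lp_feasible A B b x \<and> c \<bullet> z \<le> c \<bullet> y}"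
  using assms by (auto simp: lp_solutions_def is_arg_min_def not_less intro: order_trans)

text \<open>The optimal value turns optimality into one more inequality, indexed by
  \<open>None\<close>, with the fixed normal \<open>c\<close>. Solution sets are thus polyhedra of
  the same kind as feasible sets, and only the right-hand sides depend on the parameter.\<close>

lemma lp_solutions_halfspaces:
  assumes "y \<in> lp_solutions A B b c x"
  shows "lp_solutions A B b c x =
    {z. \<forall>i. (case i of None \<Rightarrow> c | Some i \<Rightarrow> B $ i) \<bullet> z
      \<le> (case i of None \<Rightarrow> c \<bullet> y | Some i \<Rightarrow> b $ i - (A *v x) $ i)}"
  unfolding lp_solutions_eq[OF assms] lp_feasible_eq
  by (auto split: option.splits)

lemma lp_rhs_tendsto: "x \<longlonglongrightarrow> x0 \<Longrightarrow> (\<lambda>n. b $ i - (A *v x n) $ i) \<longlonglongrightarrow> b $ i - (A *v x0) $ i"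
  for A :: "real^'d^'m"
  unfolding matrix_vector_mul_component by (intro tendsto_intros)

lemma lp_feasible_closed_graph:
  assumes "x \<longlonglongrightarrow> x0" "y \<longlonglongrightarrow> y0" "\<And>n. y n \<in> lp_feasible A B b (x n)"
  shows "y0 \<in> lp_feasible A B b x0"
  unfolding lp_feasible_eq
proof (intro CollectI allI)
  fix i
  show "B $ i \<bullet> y0 \<le> b $ i - (A *v x0) $ i"
    using assms(3) unfolding lp_feasible_eq
    by (intro LIMSEQ_le[OF tendsto_inner[OF tendsto_const assms(2)] lp_rhs_tendsto[OF assms(1)]]) auto
qed

text \<open>For \<open>z\<close> in the relative interior of the limit feasible set,
  \<open>z + (y n - y0)\<close> is eventually a feasible competitor of \<open>y n\<close>.
  Cancelling \<open>y n\<close> leaves \<open>c \<bullet> y0 \<le> c \<bullet> z\<close>, and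
  closure extends this to every feasible \<open>z\<close>.\<close>

lemma lp_solutions_closed_graph:
  assumes x: "x \<longlonglongrightarrow> x0" and y: "y \<longlonglongrightarrow> y0" "\<And>n. y n \<in> lp_solutions A B b c (x n)"
  shows "y0 \<in> lp_solutions A B b c x0"
proof -
  let ?K = "lp_feasible A B b"
  have yK: "y n \<in> ?K (x n)" for n using y(2) by (auto simp: lp_solutions_def is_arg_min_def)
  have y0K: "y0 \<in> ?K x0" by (rule lp_feasible_closed_graph[OF x y(1) yK])
  have "c \<bullet> y0 \<le> c \<bullet> z" if z: "z \<in> rel_interior (?K x0)" for z
  proof -
    have "\<forall>\<^sub>F n in sequentially. \<forall>i. B $ i \<bullet> (z + (y n - y0)) \<le> b $ i - (A *v x n) $ i"
      using yK z unfolding lp_feasible_eq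
      by (intro halfspaces_rel_interior_stable[where ?u0.0="\<lambda>i. b $ i - (A *v x0) $ i"] lp_rhs_tendsto x y) auto
    then obtain n where "z + (y n - y0) \<in> ?K (x n)"
      unfolding lp_feasible_eq using eventually_happens'[OF sequentially_bot] by blast
    then have "c \<bullet> y n \<le> c \<bullet> (z + (y n - y0))"
      using y(2)[of n] by (auto simp: lp_solutions_def is_arg_min_def not_less)
    then show ?thesis by (simp add: inner_add_right inner_diff_right)
  qed
  then have "closure (rel_interior (?K x0)) \<subseteq> {z. c \<bullet> y0 \<le> c \<bullet> z}"
    by (intro closure_minimal) (auto simp: closed_halfspace_ge)
  moreover have "closure (rel_interior (?K x0)) = ?K x0"
    unfolding lp_feasible_eq
    by (simp add: convex_closure_rel_interior convex_halfspaces closed_halfspaces)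
  ultimately show ?thesis using y0K by (auto simp: lp_solutions_def is_arg_min_def not_less)
qed

text \<open>The optimal values \<open>c \<bullet> y n\<close> are among the right-hand sides. They
  converge to \<open>c \<bullet> y0\<close>, which is the optimal value at \<open>x0\<close> by the
  closed graph.\<close>

lemma lp_solutions_rel_interior_stable:
  fixes A :: "real^'d^'m"
  assumes x: "x \<longlonglongrightarrow> x0" and y: "y \<longlonglongrightarrow> y0" "\<And>n. y n \<in> lp_solutions A B b c (x n)"
    and z: "z \<in> rel_interior (lp_solutions A B b c x0)"
  shows "\<forall>\<^sub>F n in sequentially. z + (y n - y0) \<in> lp_solutions A B b c (x n)"
proof -
  have y0: "y0 \<in> lp_solutions A B b c x0" by (rule lp_solutions_closed_graph[OF x y])
  define a where "a i = (case i of None \<Rightarrow> c | Some i \<Rightarrow> B $ i)" for i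
  define u where "u n i = (case i of None \<Rightarrow> c \<bullet> y n | Some i \<Rightarrow> b $ i - (A *v x n) $ i)" for n i
  define u0 where "u0 i = (case i of None \<Rightarrow> c \<bullet> y0 | Some i \<Rightarrow> b $ i - (A *v x0) $ i)" for i
  have S: "lp_solutions A B b c (x n) = {z. \<forall>i. a i \<bullet> z \<le> u n i}" for n
    unfolding lp_solutions_halfspaces[OF y(2)] a_def u_def ..
  have S0: "lp_solutions A B b c x0 = {z. \<forall>i. a i \<bullet> z \<le> u0 i}"
    unfolding lp_solutions_halfspaces[OF y0] a_def u0_def ..
  have "(\<lambda>n. u n i) \<longlonglongrightarrow> u0 i" for i
    unfolding u_def u0_def by (cases i) (auto intro!: tendsto_intros y lp_rhs_tendsto x)
  then have "\<forall>\<^sub>F n in sequentially. \<forall>i. a i \<bullet> (z + (y n - y0)) \<le> u n i"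
    using y(1) y(2)[unfolded S] z[unfolded S0] by (intro halfspaces_rel_interior_stable) auto
  then show ?thesis by (simp add: S)
qed

text \<open>Normalizing an unbounded sequence of feasible points yields in the limit a unit vector
  \<open>d0\<close> with \<open>B $ i \<bullet> d0 \<le> 0\<close> for all \<open>i\<close>. This
  recession direction is common to all parameters, so it would make the feasible set at
  \<open>x1\<close> unbounded too.\<close>

lemma lp_feasible_uniformly_bounded:
  fixes A :: "real^'d^'m" and B :: "real^'p^'m"
  assumes X: "bounded X" and x1: "lp_feasible A B b x1 \<noteq> {}" "bounded (lp_feasible A B b x1)"
  shows "bounded (\<Union>x\<in>X. lp_feasible A B b x)"
proof (rule ccontr)
  assume unb: "\<not> ?thesis"
  have "\<exists>x y. x \<in> X \<and> y \<in> lp_feasible A B b x \<and> real (Suc n) \<le> norm y" for n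
  proof (rule ccontr)
    assume "\<not> ?thesis"
    then have "norm y \<le> real (Suc n)" if "y \<in> (\<Union>x\<in>X. lp_feasible A B b x)" for y
      using that by (force simp: not_le)
    then show False using unb unfolding bounded_iff by blast
  qed
  then obtain x y where x: "\<And>n. x n \<in> X" and y: "\<And>n. y n \<in> lp_feasible A B b (x n)"
    and big: "\<And>n. real (Suc n) \<le> norm (y n)" by metis
  have ypos: "0 < norm (y n)" for n using big[of n] by linarith
  define d where "d n = (1 / norm (y n)) *\<^sub>R y n" for n
  have "d n \<in> sphere 0 1" for n using ypos[of n] by (simp add: d_def)
  then obtain d0 r where r: "d0 \<in> sphere 0 1" "strict_mono r" "(d \<circ> r) \<longlonglongrightarrow> d0"
    using compact_sphere[of "0 :: real^'p" 1] unfolding compact_def by metis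
  have Bd: "B $ i \<bullet> d0 \<le> 0" for i
  proof -
    have "bounded ((\<lambda>x. b $ i - A $ i \<bullet> x) ` X)"
    proof -
      obtain C where C: "\<And>x. x \<in> X \<Longrightarrow> norm x \<le> C" using X by (auto simp: bounded_iff)
      have "norm (b $ i - A $ i \<bullet> x) \<le> \<bar>b $ i\<bar> + norm (A $ i) * C" if "x \<in> X" for x
      proof -
        have "\<bar>A $ i \<bullet> x\<bar> \<le> norm (A $ i) * C"
          using Cauchy_Schwarz_ineq2[of "A $ i" x] mult_left_mono[OF C[OF that], of "norm (A $ i)"] by simp
        then show ?thesis by simp
      qed
      then show ?thesis by (auto simp: bounded_iff)
    qed
    then obtain M where M: "\<And>x. x \<in> X \<Longrightarrow> \<bar>b $ i - A $ i \<bullet> x\<bar> \<le> M" by (auto simp: bounded_iff)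
    have M0: "0 \<le> M" using M[OF x[of 0]] by linarith
    have "B $ i \<bullet> d n \<le> M * (1 / real (Suc n))" for n
    proof -
      have "B $ i \<bullet> y n \<le> M"
      proof -
        have "B $ i \<bullet> y n \<le> b $ i - A $ i \<bullet> x n"
          using y[of n] unfolding lp_feasible_eq matrix_vector_mul_component by blast
        then show ?thesis using M[OF x[of n]] by linarith
      qed
      then have "B $ i \<bullet> d n \<le> M / norm (y n)"
        using ypos[of n] by (simp add: d_def divide_right_mono)
      also have "\<dots> \<le> M / real (Suc n)" using big[of n] ypos[of n] M0 by (intro divide_left_mono) auto
      finally show ?thesis by simp
    qed
    moreover have "(\<lambda>n. M * (1 / real (Suc n))) \<longlonglongrightarrow> M * 0"
      by (intro tendsto_intros LIMSEQ_inverse_real_of_nat[unfolded inverse_eq_divide])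
    then have "((\<lambda>n. M * (1 / real (Suc n))) \<circ> r) \<longlonglongrightarrow> M * 0" by (rule LIMSEQ_subseq_LIMSEQ[OF _ r(2)])
    moreover have "(\<lambda>n. B $ i \<bullet> (d \<circ> r) n) \<longlonglongrightarrow> B $ i \<bullet> d0" by (intro tendsto_intros r(3))
    ultimately show ?thesis by (auto intro: LIMSEQ_le simp: o_def)
  qed
  obtain y1 where y1: "y1 \<in> lp_feasible A B b x1" using x1(1) by blast
  obtain C where C: "\<And>y. y \<in> lp_feasible A B b x1 \<Longrightarrow> norm y \<le> C" using x1(2) by (auto simp: bounded_iff)
  \<comment> \<open>Moving from \<open>y1\<close> by this amount along the unit vector
    \<open>d0\<close> leaves the ball of radius \<open>C\<close>.\<close>
  define t where "t = C + norm y1 + 1"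
  have t: "0 \<le> t" using C[OF y1] norm_ge_zero[of y1] unfolding t_def by linarith
  have "B $ i \<bullet> (y1 + t *\<^sub>R d0) \<le> b $ i - (A *v x1) $ i" for i
    using y1 mult_nonneg_nonpos[OF t Bd[of i]] unfolding lp_feasible_eq
    by (simp add: inner_add_right) (smt (verit))
  then have "norm (y1 + t *\<^sub>R d0) \<le> C" by (intro C) (simp add: lp_feasible_eq)
  moreover have "norm (t *\<^sub>R d0) \<le> norm (y1 + t *\<^sub>R d0) + norm y1"
    using norm_triangle_ineq4[of "y1 + t *\<^sub>R d0" y1] by simp
  ultimately show False using r(1) t by (simp add: t_def)
qed

text \<open>\<open>D\<close> is closed in \<open>X\<close> because feasible points over a convergent
  sequence of parameters stay in a bounded set, and a cluster point of them is feasible over the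
  limit. The same bound makes \<open>Y\<close> compact.\<close>

lemma lp_stable_convex_map:
  fixes A :: "real^'d^'m" and B :: "real^'p^'m" and b :: "real^'m" and c :: "real^'p"
  defines "K \<equiv> lp_feasible A B b" and "S \<equiv> lp_solutions A B b c"
  assumes X: "compact X" and bK: "\<And>x. x \<in> X \<Longrightarrow> bounded (K x)"
  assumes D: "D = {x \<in> X. K x \<noteq> {}}" "D \<noteq> {}" and Y: "Y = closure (convex hull (\<Union>x\<in>D. S x))"
  shows "compact D" "stable_convex_map D Y S"
proof -
  obtain x1 where x1: "x1 \<in> D" using D(2) by blast
  have bdd: "bounded (\<Union>x\<in>X. K x)"
    using x1 bK unfolding K_def D(1)
    by (intro lp_feasible_uniformly_bounded[of X A B b x1] compact_imp_bounded[OF X]) auto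
  have SK: "S x \<subseteq> K x" for x by (auto simp: S_def K_def lp_solutions_def is_arg_min_def)
  show "compact D" unfolding compact_def
  proof (intro allI impI)
    fix x :: "nat \<Rightarrow> real^'d" assume x: "\<forall>n. x n \<in> D"
    then have "\<forall>n. \<exists>y. y \<in> K (x n)" by (auto simp: D)
    then obtain y where y: "\<And>n. y n \<in> K (x n)" by metis
    have "\<forall>n. x n \<in> X" using x by (simp add: D)
    then obtain x0 r where r: "x0 \<in> X" "strict_mono r" "(x \<circ> r) \<longlonglongrightarrow> x0"
      using X unfolding compact_def by metis
    have "\<forall>n. (y \<circ> r) n \<in> closure (\<Union>x\<in>X. K x)"
      using y x closure_subset[of "\<Union>x\<in>X. K x"] by (fastforce simp: D)
    then obtain y0 s where s: "strict_mono s" "((y \<circ> r) \<circ> s) \<longlonglongrightarrow> y0"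
      using bdd unfolding compact_closure[symmetric] compact_def by metis
    have "y0 \<in> K x0"
      unfolding K_def
      by (rule lp_feasible_closed_graph[OF LIMSEQ_subseq_LIMSEQ[OF r(3) s(1)] s(2)])
         (use y in \<open>simp add: K_def\<close>)
    then show "\<exists>l\<in>D. \<exists>r. strict_mono r \<and> (x \<circ> r) \<longlonglongrightarrow> l"
      using r by (intro bexI[of _ x0] exI[of _ r]) (auto simp: D)
  qed
  have cK: "compact (K x)" if "x \<in> D" for x
    using that bK closed_halfspaces unfolding compact_eq_bounded_closed D(1) K_def lp_feasible_eq by auto
  have ne: "S x \<noteq> {}" if x: "x \<in> D" for x
  proof -
    have "K x \<noteq> {}" using x by (simp add: D)
    then obtain y where "y \<in> K x" "\<forall>z\<in>K x. c \<bullet> y \<le> c \<bullet> z"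
      using continuous_attains_inf[OF cK[OF x] _ continuous_on_inner[OF continuous_on_const continuous_on_id]]
      by blast
    then have "y \<in> S x" by (auto simp: S_def lp_solutions_def K_def is_arg_min_def not_less)
    then show ?thesis by blast
  qed
  have sub: "(\<Union>x\<in>D. S x) \<subseteq> Y"
    unfolding Y by (rule order_trans[OF hull_subset closure_subset])
  show "stable_convex_map D Y S"
  proof
    have "bounded (\<Union>x\<in>D. S x)"
      by (rule bounded_subset[OF bdd]) (use SK in \<open>auto simp: D\<close>)
    then show "compact Y" unfolding Y by (simp add: compact_closure bounded_convex_hull)
    fix x assume x: "x \<in> D"
    show "S x \<noteq> {}" by (rule ne[OF x])
    then obtain y where "y \<in> lp_solutions A B b c x" by (auto simp: S_def)
    from lp_solutions_halfspaces[OF this]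
    show "convex (S x)" and "compact (S x)"
      using convex_halfspaces closed_halfspaces bounded_subset[OF compact_imp_bounded[OF cK[OF x]] SK]
      by (simp_all add: S_def compact_eq_bounded_closed)
    show "S x \<subseteq> Y" using sub x by blast
  next
    fix x x0 y y0
    assume "x \<longlonglongrightarrow> x0" "y \<longlonglongrightarrow> y0" "\<And>n. y n \<in> S (x n)"
    then show "y0 \<in> S x0" unfolding S_def by (rule lp_solutions_closed_graph)
  next
    fix x x0 y y0 z
    assume "x \<longlonglongrightarrow> x0" "y \<longlonglongrightarrow> y0" "\<And>n. y n \<in> S (x n)" "z \<in> rel_interior (S x0)"
    then show "\<forall>\<^sub>F n in sequentially. z + (y n - y0) \<in> S (x n)"
      unfolding S_def by (rule lp_solutions_rel_interior_stable)
  qed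
qed

section \<open>Beliefs\<close>

text \<open>The total mass is 1, so adding \<open>C\<close> to the integrand adds \<open>C\<close>
  to the integral. The negative part has finite integral, which rules out a difference of
  infinities.\<close>

lemma ereal_integral_eq_shift:
  assumes M: "prob_space M" and f: "f \<in> borel_measurable M" and C: "0 \<le> C" "\<And>y. y \<in> space M \<Longrightarrow> - C \<le> f y"
  shows "ereal_integral M f = enn2ereal (\<integral>\<^sup>+y. ennreal (f y + C) \<partial>M) - ereal C"
proof -
  interpret prob_space M by (rule M)
  have neg: "(\<integral>\<^sup>+y. ennreal (- f y) \<partial>M) \<le> (\<integral>\<^sup>+y. ennreal C \<partial>M)"
    using C(2) by (intro nn_integral_mono ennreal_leI) (simp add: minus_le_iff)
  then have "(\<integral>\<^sup>+y. ennreal (- f y) \<partial>M) < \<top>"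
    by (simp add: emeasure_space_1 le_less_trans)
  then obtain b where b: "0 \<le> b" "(\<integral>\<^sup>+y. ennreal (- f y) \<partial>M) = ennreal b"
    by (cases "\<integral>\<^sup>+y. ennreal (- f y) \<partial>M") auto
  \<comment> \<open>Stated with sums only, because subtraction truncates in
    \<open>ennreal\<close>.\<close>
  have pt: "ennreal (f y) + ennreal C = ennreal (f y + C) + ennreal (- f y)" if "y \<in> space M" for y
    using C(1) C(2)[OF that] by (cases "0 \<le> f y") (auto simp: ennreal_neg ennreal_plus[symmetric] simp del: ennreal_plus)
  have "(\<integral>\<^sup>+y. ennreal (f y) \<partial>M) + ennreal C = (\<integral>\<^sup>+y. ennreal (f y) + ennreal C \<partial>M)"
    using f by (subst nn_integral_add) (auto simp: emeasure_space_1)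
  also have "\<dots> = (\<integral>\<^sup>+y. ennreal (f y + C) + ennreal (- f y) \<partial>M)"
    by (intro nn_integral_cong pt)
  also have "\<dots> = (\<integral>\<^sup>+y. ennreal (f y + C) \<partial>M) + ennreal b"
    using f by (subst nn_integral_add) (auto simp: b)
  finally have eq: "enn2ereal (\<integral>\<^sup>+y. ennreal (f y) \<partial>M) + ereal C
      = enn2ereal (\<integral>\<^sup>+y. ennreal (f y + C) \<partial>M) + ereal b"
    using b(1) C(1) by (metis enn2ereal_ennreal plus_ennreal.rep_eq)
  show ?thesis
    unfolding ereal_integral_def b(2) using eq b(1)
    by (cases "enn2ereal (\<integral>\<^sup>+y. ennreal (f y) \<partial>M)"; cases "enn2ereal (\<integral>\<^sup>+y. ennreal (f y + C) \<partial>M)") auto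
qed

text \<open>Its values on the Borel subsets of \<open>Y\<close> identify the belief as the
  restriction of a measure with density with respect to the Borel measure on the affine hull of
  \<open>S\<close>. The rest is integration against a density.\<close>

lemma nn_integral_belief:
  fixes S :: "'b::euclidean_space set"
  assumes S: "S \<subseteq> Y" "S \<in> sets borel" and Y: "Y \<in> sets borel"
    and sets_M: "sets M = sets (restrict_space borel Y)"
    and q: "(\<lambda>y. ennreal (\<rho> y) * indicator S y) \<in> borel_measurable borel"
    and R: "0 < hausdorff_integral_over S \<rho>" "hausdorff_integral_over S \<rho> < \<top>"
    and M: "\<And>A. A \<in> sets (restrict_space borel Y) \<Longrightarrow> emeasure M A =
      (\<integral>\<^sup>+y\<in>A \<inter> S. ennreal (\<rho> y) \<partial>hausdorff_measure (adim S)) / hausdorff_integral_over S \<rho>"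
    and f: "(\<lambda>y. ennreal (f y) * indicator Y y) \<in> borel_measurable borel"
    and f0: "\<And>y. y \<in> S \<Longrightarrow> 0 \<le> f y" and \<rho>0: "\<And>y. y \<in> S \<Longrightarrow> 0 \<le> \<rho> y"
  shows "(\<integral>\<^sup>+y. ennreal (f y) \<partial>M) = hausdorff_integral_over S (\<lambda>y. f y * \<rho> y) / hausdorff_integral_over S \<rho>"
proof -
  let ?R = "hausdorff_integral_over S \<rho>" and ?\<nu> = "hausdorff_on (adim S) (affine hull S)"
  let ?q = "\<lambda>y. ennreal (\<rho> y) * indicator S y"
  have aff: "affine hull S \<in> sets borel" by (simp add: borel_closed)
  define N where "N = density ?\<nu> (\<lambda>y. ?q y / ?R)"
  have [measurable]: "?q \<in> borel_measurable borel" by (rule q)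
  have qR: "(\<lambda>y. ?q y / ?R) \<in> borel_measurable ?\<nu>" by simp
  have "M = restrict_space N Y"
  proof (rule measure_eqI)
    show "sets M = sets (restrict_space N Y)"
      unfolding sets_M by (intro sets_restrict_space_cong) (simp add: N_def)
    fix A assume "A \<in> sets M"
    then have A: "A \<in> sets (restrict_space borel Y)" by (simp add: sets_M)
    then have AY: "A \<subseteq> Y" and Ab [measurable]: "A \<in> sets borel"
      using Y by (auto simp: sets_restrict_space)
    have "emeasure (restrict_space N Y) A = emeasure N A"
      using AY Y by (intro emeasure_restrict_space) (auto simp: N_def)
    also have "\<dots> = (\<integral>\<^sup>+y. (?q y / ?R) * indicator A y \<partial>?\<nu>)"
      unfolding N_def using qR Ab by (intro emeasure_density) auto
    also have "\<dots> = (\<integral>\<^sup>+y. (?q y * indicator A y) / ?R \<partial>?\<nu>)"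
      by (intro nn_integral_cong) (simp add: ennreal_times_divide ennreal_divide_times mult.commute)
    also have "\<dots> = (\<integral>\<^sup>+y. ?q y * indicator A y \<partial>?\<nu>) / ?R"
      by (intro nn_integral_divide) simp
    also have "(\<integral>\<^sup>+y. ?q y * indicator A y \<partial>?\<nu>)
        = (\<integral>\<^sup>+y. (?q y * indicator A y) * indicator (affine hull S) y \<partial>hausdorff_measure (adim S))"
      by (intro nn_integral_hausdorff_on aff) simp
    also have "\<dots> = (\<integral>\<^sup>+y\<in>A \<inter> S. ennreal (\<rho> y) \<partial>hausdorff_measure (adim S))"
      by (intro nn_integral_cong) (use hull_subset[of S affine] in \<open>auto split: split_indicator\<close>)
    finally show "emeasure M A = emeasure (restrict_space N Y) A" by (simp add: M[OF A])
  qed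
  then have "(\<integral>\<^sup>+y. ennreal (f y) \<partial>M) = (\<integral>\<^sup>+y. ennreal (f y) * indicator Y y \<partial>N)"
    using Y by (simp add: nn_integral_restrict_space N_def)
  also have "\<dots> = (\<integral>\<^sup>+y. (?q y / ?R) * (ennreal (f y) * indicator Y y) \<partial>?\<nu>)"
    unfolding N_def using qR f by (intro nn_integral_density) simp_all
  also have "\<dots> = (\<integral>\<^sup>+y. (ennreal (f y * \<rho> y) * indicator S y) / ?R \<partial>?\<nu>)"
    using S(1) f0 \<rho>0
    by (intro nn_integral_cong)
       (auto simp: ennreal_mult ennreal_times_divide ennreal_divide_times mult.commute split: split_indicator)
  also have "\<dots> = (\<integral>\<^sup>+y. ennreal (f y * \<rho> y) * indicator S y \<partial>?\<nu>) / ?R"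
  proof (rule nn_integral_divide)
    have "(\<lambda>y. (ennreal (f y) * indicator Y y) * ?q y) \<in> borel_measurable ?\<nu>" using f by simp
    also have "(\<lambda>y. (ennreal (f y) * indicator Y y) * ?q y) = (\<lambda>y. ennreal (f y * \<rho> y) * indicator S y)"
      using S(1) f0 \<rho>0 by (intro ext) (auto simp: ennreal_mult split: split_indicator)
    finally show "(\<lambda>y. ennreal (f y * \<rho> y) * indicator S y) \<in> borel_measurable ?\<nu>" .
  qed
  also have "(\<integral>\<^sup>+y. ennreal (f y * \<rho> y) * indicator S y \<partial>?\<nu>) = hausdorff_integral_over S (\<lambda>y. f y * \<rho> y)"
  proof (rule hausdorff_integral_over_eq[symmetric])
    have "(\<lambda>y. (ennreal (f y) * indicator Y y) * ?q y) \<in> borel_measurable borel" using f by simp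
    also have "(\<lambda>y. (ennreal (f y) * indicator Y y) * ?q y) = (\<lambda>y. ennreal (f y * \<rho> y) * indicator S y)"
      using S(1) f0 \<rho>0 by (intro ext) (auto simp: ennreal_mult split: split_indicator)
    finally show "(\<lambda>y. ennreal (f y * \<rho> y) * indicator S y) \<in> borel_measurable borel" .
  qed
  finally show ?thesis .
qed

context stable_convex_map
begin

text \<open>After the cost is shifted to be nonnegative, the expected cost is the ratio
  \<open>J / R\<close> up to the constant \<open>C\<close>; subtracting a finite constant preserves
  minimizers.\<close>

lemma bayesian_solution_exists:
  fixes \<theta> \<rho> :: "'a \<times> 'b \<Rightarrow> real"
  assumes D: "compact D" "D \<noteq> {}" and \<theta>: "lower_semicontinuous_on (D \<times> Y) \<theta>"
    and \<beta>: "belief_over D Y S \<beta>" "density_of_belief D Y S \<beta> \<rho>"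
    and \<rho>: "continuous_on (D \<times> Y) \<rho>" "\<And>p. p \<in> D \<times> Y \<Longrightarrow> 0 < \<rho> p"
  shows "\<exists>x. bayesian_solution D \<theta> \<beta> x"
proof -
  have Yb: "Y \<in> sets borel" using compact_Y by (simp add: borel_compact)
  obtain C where C: "0 \<le> C" "\<And>p. p \<in> D \<times> Y \<Longrightarrow> - C \<le> \<theta> p"
    using lower_semicontinuous_on_compact_bounded_below[OF compact_Times[OF D(1) compact_Y] \<theta>] by blast
  let ?f = "\<lambda>p. \<theta> p + C"
  have f: "lower_semicontinuous_on (D \<times> Y) ?f"
    unfolding lower_semicontinuous_on_def
  proof (intro ballI allI impI)
    fix p t assume "p \<in> D \<times> Y" "t < \<theta> p + C"
    then have "\<forall>\<^sub>F z in at p within D \<times> Y. t - C < \<theta> z"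
      using \<theta> by (auto simp: lower_semicontinuous_on_def)
    then show "\<forall>\<^sub>F z in at p within D \<times> Y. t < \<theta> z + C" by eventually_elim simp
  qed
  have f0: "0 \<le> ?f p" if "p \<in> D \<times> Y" for p using C(2)[OF that] by simp
  let ?R = "\<lambda>x. hausdorff_integral_over (S x) (\<lambda>y. \<rho> (x, y))"
  let ?J = "\<lambda>x. hausdorff_integral_over (S x) (\<lambda>y. ?f (x, y) * \<rho> (x, y))"
  have R: "0 < ?R x" "?R x < \<top>" if "x \<in> D" for x
    using \<beta>(2) that by (auto simp: density_of_belief_def hausdorff_integral_over_def Let_def)
  have "lower_semicontinuous_on (D \<times> Y) (\<lambda>p. ?f p * \<rho> p)"
    by (intro lower_semicontinuous_on_mult f f0 \<rho>)
  then obtain x where x: "x \<in> D" "\<And>x'. x' \<in> D \<Longrightarrow> ?J x / ?R x \<le> ?J x' / ?R x'"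
    using ratio_attains_minimum[OF D _ \<rho>(1) R] by blast
  have eq: "ereal_integral (\<beta> x) (\<lambda>y. \<theta> (x, y)) = enn2ereal (?J x / ?R x) - ereal C" if xD: "x \<in> D" for x
  proof -
    have b: "sets (\<beta> x) = sets (restrict_space borel Y)" "prob_space (\<beta> x)"
      using \<beta>(1) xD by (auto simp: belief_over_def space_prob_algebra)
    have sp: "space (\<beta> x) = Y" using sets_eq_imp_space_eq[OF b(1)] by (simp add: space_restrict_space)
    have fY: "(\<lambda>y. ennreal (?f (x, y)) * indicator Y y) \<in> borel_measurable borel"
      by (intro lower_semicontinuous_on_measurable[of Y] lower_semicontinuous_on_section[OF f] Yb xD order_refl)
    \<comment> \<open>The shifted cost is nonnegative on \<open>Y\<close>, so
      \<open>enn2real\<close> recovers it and measurability passes back to the reals.\<close>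
    have "(\<lambda>y. \<theta> (x, y)) \<in> borel_measurable (\<beta> x)"
    proof -
      have "(\<lambda>y. ennreal (?f (x, y))) \<in> borel_measurable (restrict_space borel Y)"
        using fY Yb by (subst borel_measurable_restrict_space_iff_ennreal) auto
      then have "(\<lambda>y. enn2real (ennreal (?f (x, y))) - C) \<in> borel_measurable (\<beta> x)"
        unfolding measurable_cong_sets[OF b(1) refl] by measurable
      then show ?thesis
        by (rule measurable_cong[THEN iffD1, rotated]) (use f0 xD sp in auto)
    qed
    then have "ereal_integral (\<beta> x) (\<lambda>y. \<theta> (x, y)) = enn2ereal (\<integral>\<^sup>+y. ennreal (?f (x, y)) \<partial>\<beta> x) - ereal C"
      using C xD sp by (intro ereal_integral_eq_shift b(2)) auto
    also have "(\<integral>\<^sup>+y. ennreal (?f (x, y)) \<partial>\<beta> x) = ?J x / ?R x"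
    proof (rule nn_integral_belief[OF subset_Y[OF xD] borel_values[OF xD] Yb b(1) _ R[OF xD] _ fY])
      show "(\<lambda>y. ennreal (\<rho> (x, y)) * indicator (S x) y) \<in> borel_measurable borel"
        by (intro lower_semicontinuous_on_measurable[of Y] borel_values subset_Y Yb xD
            lower_semicontinuous_on_section[OF continuous_on_imp_lower_semicontinuous_on[OF \<rho>(1)]])
      show "0 \<le> ?f (x, y)" "0 \<le> \<rho> (x, y)" if "y \<in> S x" for y
      proof -
        have "(x, y) \<in> D \<times> Y" using that xD subset_Y[OF xD] by blast
        then show "0 \<le> ?f (x, y)" "0 \<le> \<rho> (x, y)" using f0 less_imp_le[OF \<rho>(2)] by blast+
      qed
      show "emeasure (\<beta> x) A = (\<integral>\<^sup>+y\<in>A \<inter> S x. ennreal (\<rho> (x, y)) \<partial>hausdorff_measure (adim (S x))) / ?R x"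
        if "A \<in> sets (restrict_space borel Y)" for A
        using \<beta>(2) xD that by (simp add: density_of_belief_def Let_def hausdorff_integral_over_def)
    qed
    finally show ?thesis .
  qed
  have "bayesian_solution D \<theta> \<beta> x"
    unfolding bayesian_solution_def is_arg_min_def
    using x by (auto simp: eq not_less intro!: ereal_minus_mono simp flip: less_eq_ennreal.rep_eq)
  then show ?thesis by blast
qed

section \<open>The Neutral belief\<close>

lemma hausdorff_values:
  assumes "x \<in> D"
  shows "0 < emeasure (hausdorff_measure (adim (S x))) (S x)"
    "emeasure (hausdorff_measure (adim (S x))) (S x) < \<top>"
  unfolding emeasure_hausdorff_borel[OF borel_values[OF assms]]
  by (rule hausdorff_outer_convex_pos[OF nonempty[OF assms] convex[OF assms]])
     (rule hausdorff_outer_bounded_finite[OF nonempty[OF assms] hull_subset compact_imp_bounded[OF compact[OF assms]]])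

text \<open>\<open>measure_of\<close> returns the given set function only when it is countably
  additive. Exhibiting it as the measure of a constant density settles this.\<close>

lemma neutral_belief_eq:
  assumes x: "x \<in> D"
  defines "m \<equiv> emeasure (hausdorff_measure (adim (S x))) (S x)"
  defines "N \<equiv> restrict_space (density (hausdorff_on (adim (S x)) (S x)) (\<lambda>_. 1 / m)) Y"
  shows "neutral_belief Y S x = N"
    and "A \<in> sets (restrict_space borel Y) \<Longrightarrow>
      emeasure N A = emeasure (hausdorff_measure (adim (S x))) (A \<inter> S x) / m"
    and "sets N = sets (restrict_space borel Y)" and "space N = Y"
proof -
  have Yb: "Y \<in> sets borel" using compact_Y by (simp add: borel_compact)
  show sets: "sets N = sets (restrict_space borel Y)"
    unfolding N_def by (intro sets_restrict_space_cong) simp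
  show sp: "space N = Y" by (simp add: N_def space_restrict_space)
  have em: "emeasure N A = emeasure (hausdorff_measure (adim (S x))) (A \<inter> S x) / m"
    if A: "A \<in> sets (restrict_space borel Y)" for A
  proof -
    have AY: "A \<subseteq> Y" and Ab: "A \<in> sets borel"
      using A Yb by (auto simp: sets_restrict_space)
    have "emeasure N A = emeasure (density (hausdorff_on (adim (S x)) (S x)) (\<lambda>_. 1 / m)) A"
      unfolding N_def using AY Yb by (intro emeasure_restrict_space) auto
    also have "\<dots> = 1 / m * emeasure (hausdorff_on (adim (S x)) (S x)) A"
      using Ab by (intro emeasure_density_const) simp
    also have "emeasure (hausdorff_on (adim (S x)) (S x)) A = emeasure (hausdorff_measure (adim (S x))) (A \<inter> S x)"
      using Ab borel_values[OF x] by (simp add: emeasure_hausdorff_on emeasure_hausdorff_borel)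
    finally show ?thesis by (simp add: ennreal_divide_times)
  qed
  then show "A \<in> sets (restrict_space borel Y) \<Longrightarrow>
      emeasure N A = emeasure (hausdorff_measure (adim (S x))) (A \<inter> S x) / m" .
  have "neutral_belief Y S x = measure_of (space N) (sets N) (emeasure N)"
    unfolding neutral_belief_def Let_def sp sets
  proof (rule measure_of_eq)
    show "sets (restrict_space borel Y) \<subseteq> Pow Y"
      using sets.space_closed[of "restrict_space borel Y"] by (simp add: space_restrict_space)
    fix A assume "A \<in> sigma_sets Y (sets (restrict_space borel Y))"
    then have "A \<in> sets (restrict_space borel Y)"
      using sets.sigma_sets_eq[of "restrict_space borel Y"] by (simp add: space_restrict_space)
    then show "emeasure (hausdorff_measure (adim (S x))) (A \<inter> S x) / emeasure (hausdorff_measure (adim (S x))) (S x)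
        = emeasure N A" by (simp add: em m_def)
  qed
  then show "neutral_belief Y S x = N" by (simp add: measure_of_of_measure)
qed

lemma neutral_belief_over: "belief_over D Y S (neutral_belief Y S)"
  unfolding belief_over_def
proof (intro ballI conjI)
  fix x assume x: "x \<in> D"
  have Yb: "Y \<in> sets borel" using compact_Y by (simp add: borel_compact)
  have one: "emeasure (hausdorff_measure (adim (S x))) (S x) / emeasure (hausdorff_measure (adim (S x))) (S x) = 1"
    using hausdorff_values[OF x] by (intro ennreal_divide_self) auto
  have Y: "Y \<in> sets (restrict_space borel Y)" "S x \<in> sets (restrict_space borel Y)"
    using Yb borel_values[OF x] subset_Y[OF x] by (auto simp: sets_restrict_space_iff)
  have "Y \<inter> S x = S x" using subset_Y[OF x] by blast
  then show "neutral_belief Y S x \<in> space (prob_algebra (restrict_space borel Y))"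
    using neutral_belief_eq[OF x] Y one
    by (auto simp: space_prob_algebra intro!: prob_spaceI)
  show "emeasure (neutral_belief Y S x) (S x) = 1"
    using neutral_belief_eq[OF x] Y one by simp
qed

lemma neutral_belief_density: "density_of_belief D Y S (neutral_belief Y S) (\<lambda>_. 1)"
  unfolding density_of_belief_def Let_def
proof (intro ballI conjI)
  fix x assume x: "x \<in> D"
  let ?H = "hausdorff_measure (adim (S x))"
  have Yb: "Y \<in> sets borel" using compact_Y by (simp add: borel_compact)
  have I: "(\<integral>\<^sup>+y\<in>A. ennreal 1 \<partial>?H) = emeasure ?H A" if "A \<in> sets borel" for A
    using that by (simp add: borel_in_sets_hausdorff)
  show "(\<lambda>y. 1) \<in> borel_measurable (restrict_space ?H (S x))" by simp
  show "0 < (\<integral>\<^sup>+y\<in>S x. ennreal 1 \<partial>?H)" "(\<integral>\<^sup>+y\<in>S x. ennreal 1 \<partial>?H) < \<infinity>"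
    using hausdorff_values[OF x] by (simp_all only: I[OF borel_values[OF x]] infinity_ennreal_def)
  fix A assume A: "A \<in> sets (restrict_space borel Y)"
  then have "A \<inter> S x \<in> sets borel" using Yb borel_values[OF x] by (auto simp: sets_restrict_space)
  then show "emeasure (neutral_belief Y S x) A
      = (\<integral>\<^sup>+y\<in>A \<inter> S x. ennreal 1 \<partial>?H) / (\<integral>\<^sup>+y\<in>S x. ennreal 1 \<partial>?H)"
    using neutral_belief_eq(1,2)[OF x] A by (simp only: I borel_values[OF x])
qed simp_all

end

theorem corollary2:
  fixes A :: "real ^ 'd ^ 'm" and B :: "real ^ 'p ^ 'm"
    and b :: "real ^ 'm" and c :: "real ^ 'p"
    and X D :: "(real ^ 'd) set" and Y :: "(real ^ 'p) set"
    and K S :: "real ^ 'd \<Rightarrow> (real ^ 'p) set"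
    and \<theta> :: "(real ^ 'd) \<times> (real ^ 'p) \<Rightarrow> real"
  assumes K_def: "K = (\<lambda>x. {y. A *v x + B *v y \<le> b})"
    and S_def: "S = (\<lambda>x. {y. is_arg_min (\<lambda>z. c \<bullet> z) (\<lambda>z. z \<in> K x) y})"
    and D_def: "D = {x \<in> X. K x \<noteq> {}}"
    and Y_def: "Y = closure (convex hull (\<Union>x\<in>D. S x))"
    and compact_X: "compact X"
    and lsc: "lower_semicontinuous_on (X \<times> Y) \<theta>"
    and bounded_K: "\<And>x. x \<in> X \<Longrightarrow> bounded (K x)"
    and nonempty: "D \<noteq> {}"
  shows "(\<exists>x. bayesian_solution D \<theta> (neutral_belief Y S) x) \<and>
    (\<forall>\<beta> \<rho>. belief_over D Y S \<beta> \<longrightarrow> density_of_belief D Y S \<beta> \<rho> \<longrightarrow>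
       continuous_on (D \<times> Y) \<rho> \<longrightarrow> (\<forall>x\<in>D. \<forall>y\<in>Y. 0 < \<rho> (x, y)) \<longrightarrow>
       (\<exists>x. bayesian_solution D \<theta> \<beta> x))"
proof -
  have K: "K = lp_feasible A B b" unfolding K_def lp_feasible_def ..
  have S: "S = lp_solutions A B b c" unfolding S_def K lp_solutions_def ..
  note map = lp_stable_convex_map[of X A B b D Y c, OF compact_X bounded_K[unfolded K]
      D_def[unfolded K] nonempty Y_def[unfolded S], folded S]
  interpret stable_convex_map D Y S by (rule map(2))
  have D: "compact D" by (rule map(1))
  have \<theta>: "lower_semicontinuous_on (D \<times> Y) \<theta>"
    by (rule lower_semicontinuous_on_subset[OF lsc]) (auto simp: D_def)
  \<comment> \<open>The Neutral belief is the instance with constant density 1.\<close>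
  have "\<exists>x. bayesian_solution D \<theta> (neutral_belief Y S) x"
    by (rule bayesian_solution_exists[OF D \<open>D \<noteq> {}\<close> \<theta> neutral_belief_over neutral_belief_density])
       (auto intro: continuous_on_const)
  moreover have "\<exists>x. bayesian_solution D \<theta> \<beta> x"
    if "belief_over D Y S \<beta>" "density_of_belief D Y S \<beta> \<rho>" "continuous_on (D \<times> Y) \<rho>"
      "\<forall>x\<in>D. \<forall>y\<in>Y. 0 < \<rho> (x, y)" for \<beta> \<rho>
    using that by (intro bayesian_solution_exists[OF D \<open>D \<noteq> {}\<close> \<theta>, of \<beta> \<rho>]) auto
  ultimately show ?thesis by blast
qed

end
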